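(* Let $X=[0,1]$, $S=[\underline s,\bar s]$, $\bar u\in\mathcal{K}(X)$ with $\partial\bar u(X)\subseteq S$, and let $\mu,\nu$ be finite signed Radon measures on $X$, where $\mu$ admits a density on $(0,1)$, i.e. $\mu(A)=\int_A\psi\,\mathrm{d}(\delta_1-\delta_0+\lambda)$ for an integrable $\psi$ ($\lambda$ Lebesgue measure). Then: (1) If $\bar u'\equiv\bar s$ on $X$, there is a selection $\underline u\mapsto u_{\underline u}\in\arg\max_{u\in\mathcal{U}_{\underline u}}\int_X u\,\mathrm{d}\mu$ defined on $\mathcal{K}^0_{\bar u,S}$ which is linear in the sense that $u_{\alpha\underline u_1+(1-\alpha)\underline u_2}=\alpha u_{\underline u_1}+(1-\alpha)u_{\underline u_2}$ for all $\underline u_1,\underline u_2\in\mathcal{K}^0_{\bar u,S}$, $\alpha\in[0,1]$; in particular $V(\underline u)=\int_X u_{\underline u}\,\mathrm{d}\nu$ is affine on $\mathcal{K}^0_{\bar u,S}$. (2) Symmetrically, if $\bar u'\equiv\underline s$ on $X$, the same conclusion holds on $\mathcal{K}^1_{\bar u,S}$. (3) If $\nu=\mu$, then $V(\underline u)=\max_{u\in\mathcal{U}_{\underline u}}\int_X u\,\mathrm{d}\mu$ is concave on $\mathcal{K}_{\bar u,S}$.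
   Context: $\mathcal{K}(X)$ is the set of continuous convex functions on $X$; $\partial u(X)=\bigcup_{x\in\mathrm{int}X}\partial u(x)$ (subdifferentials). $\mathcal{K}_{\bar u,S}=\{u\in\mathcal{K}(X): u\le\bar u,\ \partial u(X)\subseteq S\}$; $\mathcal{K}^0_{\bar u,S}=\{u\in\mathcal{K}_{\bar u,S}: u(0)=\bar u(0)\}$; $\mathcal{K}^1_{\bar u,S}=\{u\in\mathcal{K}_{\bar u,S}: u(1)=\bar u(1)\}$. For $\underline u\in\mathcal{K}_{\bar u,S}$, $\mathcal{U}_{\underline u}=\{u\in\mathcal{K}_{\bar u,S}: u\ge\underline u\}$ (a convex function interval with lower boundary $\underline u$). *)

theory Defs
  imports "HOL-Analysis.Analysis"
begin

text \<open>Throughout, X = [0,1]. Functions are of type real => real; only their values on X matter.\<close>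

definition subdiffX :: "(real \<Rightarrow> real) \<Rightarrow> real \<Rightarrow> real set" where
  "subdiffX u x = {s. \<forall>y\<in>{0..1}. u x + s * (y - x) \<le> u y}"

definition KX :: "(real \<Rightarrow> real) set" where
  "KX = {u. convex_on {0..1} u \<and> continuous_on {0..1} u}"

definition KS :: "(real \<Rightarrow> real) \<Rightarrow> real \<Rightarrow> real \<Rightarrow> (real \<Rightarrow> real) set" where
  "KS ubar sl sh = {u \<in> KX. (\<forall>x\<in>{0..1}. u x \<le> ubar x) \<and>
                              (\<forall>x\<in>{0<..<1}. subdiffX u x \<subseteq> {sl..sh})}"

definition KS0 :: "(real \<Rightarrow> real) \<Rightarrow> real \<Rightarrow> real \<Rightarrow> (real \<Rightarrow> real) set" where
  "KS0 ubar sl sh = {u \<in> KS ubar sl sh. u 0 = ubar 0}"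

definition KS1 :: "(real \<Rightarrow> real) \<Rightarrow> real \<Rightarrow> real \<Rightarrow> (real \<Rightarrow> real) set" where
  "KS1 ubar sl sh = {u \<in> KS ubar sl sh. u 1 = ubar 1}"

definition Uint :: "(real \<Rightarrow> real) \<Rightarrow> real \<Rightarrow> real \<Rightarrow> (real \<Rightarrow> real) \<Rightarrow> (real \<Rightarrow> real) set" where
  "Uint ubar sl sh ul = {u \<in> KS ubar sl sh. \<forall>x\<in>{0..1}. ul x \<le> u x}"

text \<open>Integral of u against mu = psi d(delta_1 - delta_0 + lambda) on X.\<close>
definition int_mu :: "(real \<Rightarrow> real) \<Rightarrow> (real \<Rightarrow> real) \<Rightarrow> real" where
  "int_mu psi u = psi 1 * u 1 - psi 0 * u 0 + (LBINT x:{0..1}. psi x * u x)"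

text \<open>Integral of u against a finite signed Radon measure nu on X, given via its Jordan
  decomposition nu = nup - nun (finite Borel measures, restricted to X).\<close>
definition int_signed :: "real measure \<Rightarrow> real measure \<Rightarrow> (real \<Rightarrow> real) \<Rightarrow> real" where
  "int_signed nup nun u = set_lebesgue_integral nup {0..1} u - set_lebesgue_integral nun {0..1} u"

definition linear_argmax_selection ::
  "(real \<Rightarrow> real) \<Rightarrow> real \<Rightarrow> real \<Rightarrow> (real \<Rightarrow> real) \<Rightarrow> (real \<Rightarrow> real) set
     \<Rightarrow> ((real \<Rightarrow> real) \<Rightarrow> (real \<Rightarrow> real)) \<Rightarrow> bool" where
  "linear_argmax_selection ubar sl sh psi D sel \<longleftrightarrow>
     (\<forall>ul\<in>D. sel ul \<in> Uint ubar sl sh ul \<and>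
              (\<forall>u\<in>Uint ubar sl sh ul. int_mu psi u \<le> int_mu psi (sel ul))) \<and>
     (\<forall>ul1\<in>D. \<forall>ul2\<in>D. \<forall>a\<in>{0..1::real}. \<forall>x\<in>{0..1}.
        sel (\<lambda>y. a * ul1 y + (1 - a) * ul2 y) x = a * sel ul1 x + (1 - a) * sel ul2 x)"

end

theory Submission
  imports Defs "HOL-Complex_Analysis.Great_Picard"
begin

text \<open>If \<open>ubar\<close> is affine with slope \<open>sh\<close>, then \<open>w = ubar - u\<close> ranges over nondecreasing concave
  functions with \<open>w 0 = 0\<close>, i.e. mixtures \<open>w x = \<integral> min x t dm(t)\<close> with \<open>m \<ge> 0\<close>, and the problem
  becomes to minimise \<open>J w = \<integral> c dm\<close> over \<open>w \<le> ubar - ul\<close>, where \<open>c t = J (min \<cdot> t)\<close>. Let \<open>d\<close> be the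
  largest convex nonincreasing minorant of \<open>c\<close>. Interpolating \<open>w\<close> linearly over the gaps of the
  contact set of \<open>c\<close> and \<open>d\<close>, and keeping it constant after the last contact point, defines a linear
  operator \<open>L\<close>, which does not depend on \<open>ul\<close>, with \<open>J (L w) = \<integral> d dm\<close>. Since \<open>d \<le> c\<close>,
  \<open>J (L w) \<le> J w\<close>; since \<open>d\<close> is convex and nonincreasing, \<open>J \<circ> L\<close> is antitone on the cone. Hence
  \<open>L (ubar - ul)\<close> is optimal and \<open>ul \<mapsto> ubar - L (ubar - ul)\<close> is the linear selection. The integrals over
  \<open>m\<close> become finite sums for the piecewise linear interpolants of \<open>w\<close>, which suffices by continuity
  of \<open>J\<close>. The case of slope \<open>sl\<close> follows by the reflection \<open>x \<mapsto> 1 - x\<close>. Concavity of the value holds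
  because mixtures of feasible functions are feasible for the mixed lower boundary, and maximisers
  exist by Arzela-Ascoli.\<close>

section \<open>The decreasing convex envelope\<close>

text \<open>\<open>G\<close> collects the pairs of a slope \<open>b\<close> and a point where \<open>c\<close> touches its supporting line of
  slope \<open>b\<close>. The slope is taken maximal among those having a touching point \<open>p \<le> x\<close>.\<close>
lemma supporting_line:
  fixes c :: "real \<Rightarrow> real"
  assumes lip_on: "\<forall>x\<in>{0..1}. \<forall>y\<in>{0..1}. \<bar>c x - c y\<bar> \<le> B * \<bar>x - y\<bar>"
    and G_def: "G = {(b, t). b \<in> {-B..0} \<and> t \<in> {0..1} \<and> (\<forall>y\<in>{0..1}. c t - b * t \<le> c y - b * y)}"
  shows "compact G" and "(-B, 0) \<in> G"
    and "x \<in> {0..1} \<Longrightarrow> \<exists>b p. (b, p) \<in> G \<and> p \<le> x \<and> (b = 0 \<or> (\<exists>q\<ge>x. (b, q) \<in> G))"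
proof -
  have lip: "\<bar>c x - c y\<bar> \<le> B * \<bar>x - y\<bar>" if "x \<in> {0..1}" "y \<in> {0..1}" for x y
    using lip_on that by blast
  have "0 \<le> B" using lip[of 0 1] by auto
  have cont: "continuous_on {0..1} c"
  proof (rule lipschitz_on_continuous_on[of B])
    show "B-lipschitz_on {0..1} c"
      using lip \<open>0 \<le> B\<close> by (intro lipschitz_onI) (auto simp: dist_real_def)
  qed
  \<comment> \<open>\<open>F y\<close> is the closed condition that the line of slope
    \<open>b\<close> through the graph point over \<open>t\<close> does not exceed \<open>c\<close>
    at \<open>y\<close>. Thus \<open>G\<close> is an intersection of closed subsets of a
    rectangle.\<close>
  define F where "F y = {z\<in>{-B..0}\<times>{0..1}. c (snd z) - fst z * snd z \<le> c y - fst z * y}" for y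
  have c_snd: "continuous_on ({-B..0}\<times>{0..1}) (\<lambda>z. c (snd z))"
    by (rule continuous_on_compose2[OF cont]) (auto intro: continuous_on_snd continuous_on_id)
  have "closed (F y)" for y
    unfolding F_def
    by (rule continuous_on_closed_Collect_le)
      (intro continuous_on_diff continuous_on_mult c_snd continuous_on_fst continuous_on_snd
        continuous_on_id continuous_on_const closed_Times closed_atLeastAtMost)+
  then have "compact (({-B..0} \<times> {0..1}) \<inter> (\<Inter>y\<in>{0..1}. F y))"
    by (intro compact_Int_closed compact_Times compact_Icc closed_INT) auto
  moreover have "G = ({-B..0} \<times> {0..1}) \<inter> (\<Inter>y\<in>{0..1}. F y)"
    unfolding G_def F_def by auto
  ultimately show cG: "compact G" by simp
  \<comment> \<open>By the Lipschitz bound, \<open>c y + B * y\<close> is nondecreasing in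
    \<open>y\<close>, so its minimum is at \<open>0\<close>.\<close>
  show G0: "(-B, 0) \<in> G"
    unfolding G_def using lip[of 0] \<open>0 \<le> B\<close> by (fastforce simp: abs_le_iff)
  assume x: "x \<in> {0..1}"
  define P where "P = fst ` (G \<inter> (UNIV \<times> {..x}))"
  define Q where "Q = fst ` (G \<inter> (UNIV \<times> {x..}))"
  have "compact P" "compact Q" unfolding P_def Q_def
    by (intro compact_continuous_image continuous_intros compact_Int_closed cG closed_Times
        closed_UNIV closed_atMost closed_atLeast)+
  have "-B \<in> P" unfolding P_def using G0 x by force
  then obtain b where b: "b \<in> P" "\<And>b'. b' \<in> P \<Longrightarrow> b' \<le> b"
    using compact_attains_sup[OF \<open>compact P\<close>] by blast
  from b(1) obtain p where p: "(b, p) \<in> G" "p \<le> x" unfolding P_def by auto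
  have bb: "b \<in> {-B..0}" using p(1) by (simp add: G_def)
  have "b \<in> Q" if "b \<noteq> 0"
  proof -
    have "b < 0" using bb that by auto
    \<comment> \<open>Every larger slope \<open>b'\<close> has some touching point, namely a
      minimiser of \<open>c t - b' * t\<close>, and maximality of \<open>b\<close> forces it to the
      right of \<open>x\<close>. Letting \<open>b'\<close> decrease to \<open>b\<close>, closedness
      of \<open>Q\<close> gives a touching point of slope \<open>b\<close> there as well.\<close>
    have *: "b' \<in> Q" if "b' \<in> {b<..0}" for b'
    proof -
      have "continuous_on {0..1} (\<lambda>t. c t - b' * t)" by (intro continuous_intros cont)
      then obtain t where t: "t \<in> {0..1}" "\<forall>y\<in>{0..1}. c t - b' * t \<le> c y - b' * y"
        using continuous_attains_inf[of "{0..1::real}" "\<lambda>t. c t - b' * t"] by auto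
      then have tG: "(b', t) \<in> G" using that bb by (auto simp: G_def)
      have "b' \<notin> P" using b(2)[of b'] that by auto
      then have "\<not> t \<le> x" using tG unfolding P_def by force
      then show ?thesis using tG unfolding Q_def by force
    qed
    have "closure {b<..0} \<subseteq> Q"
      using * \<open>compact Q\<close> by (intro closure_minimal compact_imp_closed) auto
    then show ?thesis using \<open>b < 0\<close> by auto
  qed
  then have "b = 0 \<or> (\<exists>q\<ge>x. (b, q) \<in> G)" unfolding Q_def by force
  then show "\<exists>b p. (b, p) \<in> G \<and> p \<le> x \<and> (b = 0 \<or> (\<exists>q\<ge>x. (b, q) \<in> G))" using p by blast
qed

text \<open>\<open>l x\<close> and \<open>r x\<close> are the neighbours of \<open>x\<close> in the contact set, with \<open>r x = l x\<close> and (by division by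
  zero) \<open>\<theta> x = 0\<close> when \<open>x\<close> lies beyond the last contact point; \<open>d\<close> is the envelope. The symmetric
  kernel in the fifth property is \<open>L\<close> applied to \<open>min \<cdot> t\<close>.\<close>
lemma decreasing_convex_envelope:
  fixes c :: "real \<Rightarrow> real"
  assumes lip: "\<forall>x\<in>{0..1}. \<forall>y\<in>{0..1}. \<bar>c x - c y\<bar> \<le> B * \<bar>x - y\<bar>"
  obtains l r \<theta> d :: "real \<Rightarrow> real" where
    "\<And>x. x \<in> {0..1} \<Longrightarrow> l x \<in> {0..1}"
    "\<And>x. x \<in> {0..1} \<Longrightarrow> r x \<in> {0..1}"
    "\<And>x. x \<in> {0..1} \<Longrightarrow> \<theta> x \<in> {0..1}"
    "\<And>x. x \<in> {0..1} \<Longrightarrow> (1 - \<theta> x) * l x + \<theta> x * r x \<le> x"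
    "\<And>x t. x \<in> {0..1} \<Longrightarrow> t \<in> {0..1} \<Longrightarrow>
       (1 - \<theta> x) * min (l x) t + \<theta> x * min (r x) t = (1 - \<theta> t) * min (l t) x + \<theta> t * min (r t) x"
    "\<And>x. d x = (1 - \<theta> x) * c (l x) + \<theta> x * c (r x)"
    "\<And>x. x \<in> {0..1} \<Longrightarrow> d x \<le> c x"
    "\<And>x. x \<in> {0..1} \<Longrightarrow> \<exists>b\<le>0. \<forall>y\<in>{0..1}. d x + b * (y - x) \<le> d y"
proof -
  define G where "G = {(b, t). b \<in> {-B..0} \<and> t \<in> {0..1} \<and> (\<forall>y\<in>{0..1}. c t - b * t \<le> c y - b * y)}"
  note sl = supporting_line[OF lip G_def]
  define C where "C = snd ` G"
  have cC: "compact C" unfolding C_def by (intro compact_continuous_image continuous_intros sl)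
  have C01: "C \<subseteq> {0..1}" unfolding C_def G_def by auto
  have "0 \<in> C" unfolding C_def using sl(2) by force
  define R where "R x \<longleftrightarrow> C \<inter> {x..} \<noteq> {}" for x
  define l where "l x = Sup (C \<inter> {..x})" for x
  define r where "r x = (if R x then Inf (C \<inter> {x..}) else l x)" for x
  define \<theta> where "\<theta> x = (x - l x) / (r x - l x)" for x
  define d where "d x = (1 - \<theta> x) * c (l x) + \<theta> x * c (r x)" for x
  have lC: "l x \<in> C \<and> l x \<le> x \<and> (\<forall>y\<in>C. y \<le> x \<longrightarrow> y \<le> l x)" if "x \<in> {0..1}" for x
  proof -
    have "compact (C \<inter> {..x})" "C \<inter> {..x} \<noteq> {}" using cC \<open>0 \<in> C\<close> that by (auto intro: compact_Int_closed)
    from compact_attains_sup[OF this] obtain m where m: "m \<in> C" "m \<le> x" "\<forall>y\<in>C. y \<le> x \<longrightarrow> y \<le> m" by auto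
    then have "l x = m" unfolding l_def by (intro cSup_eq_maximum) auto
    with m show ?thesis by simp
  qed
  have rC: "r x \<in> C \<and> x \<le> r x \<and> (\<forall>y\<in>C. x \<le> y \<longrightarrow> r x \<le> y)" if "R x" for x
  proof -
    have "compact (C \<inter> {x..})" "C \<inter> {x..} \<noteq> {}" using cC that by (auto intro: compact_Int_closed simp: R_def)
    from compact_attains_inf[OF this] obtain m where m: "m \<in> C" "x \<le> m" "\<forall>y\<in>C. x \<le> y \<longrightarrow> m \<le> y" by auto
    then have "Inf (C \<inter> {x..}) = m" by (intro cInf_eq_minimum) auto
    with m that show ?thesis by (simp add: r_def)
  qed
  have r0: "r x = l x" if "\<not> R x" for x using that by (simp add: r_def)
  have l01: "l x \<in> {0..1}" and r01: "r x \<in> {0..1}" if "x \<in> {0..1}" for x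
    using lC[OF that] rC[of x] r0[of x] C01 by (cases "R x"; auto)+
  have th0: "\<theta> x = 0" if "\<not> R x" for x using r0[OF that] by (simp add: \<theta>_def)
  have th01: "\<theta> x \<in> {0..1}" if "x \<in> {0..1}" for x
  proof (cases "R x \<and> l x < r x")
    case True
    then show ?thesis using lC[OF that] rC[of x] by (simp add: \<theta>_def)
  next
    case False
    then have "r x = l x" using lC[OF that] rC[of x] r0[of x] by fastforce
    then show ?thesis by (simp add: \<theta>_def)
  qed
  have mean: "(1 - \<theta> x) * l x + \<theta> x * r x = x" if "x \<in> {0..1}" "R x" for x
  proof (cases "l x < r x")
    case True
    then have "\<theta> x * (r x - l x) = x - l x" by (simp add: \<theta>_def)
    then show ?thesis by (simp add: algebra_simps)
  next
    case False
    then have "l x = x" "r x = x" using lC[OF that(1)] rC[OF that(2)] by auto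
    then show ?thesis by (simp add: algebra_simps)
  qed
  have mean': "(1 - \<theta> x) * l x + \<theta> x * r x \<le> x" if "x \<in> {0..1}" for x
    using mean[OF that] th0[of x] lC[OF that] by (cases "R x") auto
  \<comment> \<open>If a contact point separates \<open>x\<close> from \<open>t\<close>, both sides
    equal \<open>x\<close>. Otherwise both points lie in one gap, or both beyond the last contact
    point, where both sides equal \<open>l x\<close>.\<close>
  have sym_less: "(1 - \<theta> x) * min (l x) t + \<theta> x * min (r x) t = (1 - \<theta> t) * min (l t) x + \<theta> t * min (r t) x"
    if x: "x \<in> {0..1}" and t: "t \<in> {0..1}" and "x < t" for x t
  proof (cases "\<exists>y\<in>C. x \<le> y \<and> y \<le> t")
    case True
    then obtain y where y: "y \<in> C" "x \<le> y" "y \<le> t" by auto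
    then have "R x" by (auto simp: R_def)
    have "x \<le> l t" "r x \<le> t" using lC[OF t] rC[OF \<open>R x\<close>] y by force+
    moreover have "x \<le> r t" using rC[of t] r0[of t] \<open>x \<le> l t\<close> \<open>x < t\<close> by (cases "R t") auto
    moreover have "l x \<le> t" using lC[OF x] \<open>x < t\<close> by auto
    ultimately show ?thesis using mean[OF x \<open>R x\<close>] by (simp add: min_def algebra_simps)
  next
    case False
    have "l x = l t"
    proof (rule antisym)
      show "l x \<le> l t" using lC[OF x] lC[OF t] \<open>x < t\<close> by auto
      have "l t < x" using lC[OF t] False by force
      then show "l t \<le> l x" using lC[OF x] lC[OF t] by auto
    qed
    show ?thesis
    proof (cases "R x")
      case True
      have "t < r x" using rC[OF True] False by force
      then have "R t" using rC[OF True] by (force simp: R_def)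
      have "r x = r t"
        using rC[OF True] rC[OF \<open>R t\<close>] \<open>t < r x\<close> \<open>x < t\<close> by (intro antisym) auto
      \<comment> \<open>Within the gap from \<open>a\<close> to \<open>b\<close>, both sides equal
        the expression \<open>a + (x - a) * (t - a) / (b - a)\<close>, which is symmetric in
        \<open>x\<close> and \<open>t\<close>.\<close>
      define a b where "a = l t" and "b = r t"
      have *: "l x = a" "l t = a" "r x = b" "r t = b" "a < x" "x < t" "t < b"
        using \<open>l x = l t\<close> \<open>r x = r t\<close> \<open>t < r x\<close> \<open>x < t\<close> lC[OF x] False by (auto simp: a_def b_def le_less)
      have "(1 - \<theta> x) * a + \<theta> x * t = a + (x - a) * (t - a) / (b - a)"
        "(1 - \<theta> t) * a + \<theta> t * x = a + (x - a) * (t - a) / (b - a)"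
        by (simp_all add: \<theta>_def * algebra_simps diff_divide_distrib add_divide_distrib)
      then show ?thesis using * by simp
    next
      case False
      then have "\<not> R t" using \<open>x < t\<close> by (force simp: R_def)
      then show ?thesis using th0 False \<open>l x = l t\<close> lC[OF x] \<open>x < t\<close> by simp
    qed
  qed
  have sym: "(1 - \<theta> x) * min (l x) t + \<theta> x * min (r x) t = (1 - \<theta> t) * min (l t) x + \<theta> t * min (r t) x"
    if "x \<in> {0..1}" "t \<in> {0..1}" for x t
    using sym_less[OF that] sym_less[OF that(2,1)] by (cases x t rule: linorder_cases) auto
  \<comment> \<open>A line of nonpositive slope below \<open>c\<close> that passes through
    \<open>(x, d x)\<close> yields both \<open>d x \<le> c x\<close> and a subgradient of
    \<open>d\<close> at \<open>x\<close>.\<close>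
  have line: "\<exists>b\<le>0. \<exists>g. (\<forall>y\<in>{0..1}. g + b * y \<le> c y) \<and> d x = g + b * x" if x: "x \<in> {0..1}" for x
  proof -
    obtain b p where bp: "(b, p) \<in> G" "p \<le> x" "b = 0 \<or> (\<exists>q\<ge>x. (b, q) \<in> G)" using sl(3)[OF x] by blast
    define g where "g = c p - b * p"
    have b0: "b \<le> 0" and gl: "g + b * y \<le> c y" if "y \<in> {0..1}" for y
      using bp(1) that unfolding G_def g_def by (auto simp: algebra_simps)
    then have "b \<le> 0" using x by blast
    have touch: "c q = g + b * q" if "(b, q) \<in> G" for q
      using bp(1) that unfolding G_def g_def by (force simp: algebra_simps)
    \<comment> \<open>The contact at \<open>y\<close> may belong to another slope \<open>b'\<close>.
      Its supporting line stays below \<open>c\<close> at \<open>p\<close> and at \<open>q\<close>,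
      where \<open>c\<close> meets the line of slope \<open>b\<close>; the sign of
      \<open>b' - b\<close> decides which of the two comparisons bounds \<open>c y\<close>. When
      \<open>b = 0\<close>, the comparison at \<open>p\<close> suffices because
      \<open>b' \<le> 0\<close>.\<close>
    have between: "c y = g + b * y" if y: "y \<in> C" "p \<le> y" and q: "b = 0 \<or> (\<exists>q\<ge>y. (b, q) \<in> G)" for y
    proof -
      obtain b' where b': "(b', y) \<in> G" using y by (auto simp: C_def)
      have y01: "y \<in> {0..1}" "b' \<le> 0" using b' by (auto simp: G_def)
      have min': "c y - b' * y \<le> c z - b' * z" if "z \<in> {0..1}" for z using b' that by (auto simp: G_def)
      have P: "c y \<le> g + b * p + b' * (y - p)"
        using min'[of p] bp(1) touch[OF bp(1)] by (auto simp: G_def algebra_simps)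
      have "c y \<le> g + b * y"
      proof (cases "b = 0")
        case True
        have "b' * (y - p) \<le> 0" using y01 y by (simp add: mult_nonpos_nonneg)
        then show ?thesis using P True by simp
      next
        case False
        then obtain q where q: "q \<ge> y" "(b, q) \<in> G" using q by auto
        have Q: "c y \<le> g + b * q + b' * (y - q)"
          using min'[of q] q touch[OF q(2)] by (auto simp: G_def algebra_simps)
        have "(b' - b) * (y - p) \<le> 0 \<or> (b' - b) * (y - q) \<le> 0"
          using y q by (cases "b' \<le> b") (auto simp: mult_nonpos_nonneg mult_nonneg_nonpos)
        then show ?thesis using P Q by (auto simp: algebra_simps)
      qed
      then show ?thesis using gl[OF y01(1)] by simp
    qed
    have pC: "p \<in> C" using bp(1) by (force simp: C_def)
    have cl: "c (l x) = g + b * l x"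
      using lC[OF x] pC bp by (intro between) (auto intro: order.trans)
    have "d x = g + b * x"
    proof (cases "R x")
      case True
      have "b = 0 \<or> (\<exists>q\<ge>r x. (b, q) \<in> G)"
      proof (rule disjE[OF bp(3)])
        assume "\<exists>q\<ge>x. (b, q) \<in> G"
        then obtain q where q: "q \<ge> x" "(b, q) \<in> G" by auto
        then have "q \<in> C" by (force simp: C_def)
        then show ?thesis using rC[OF True] q by auto
      qed auto
      then have cr: "c (r x) = g + b * r x"
        using rC[OF True] bp by (intro between) auto
      have "d x = g + b * ((1 - \<theta> x) * l x + \<theta> x * r x)"
        unfolding d_def cl cr by (simp add: algebra_simps)
      then show ?thesis using mean[OF x True] by simp
    next
      case False
      \<comment> \<open>Beyond the last contact point no touching point \<open>q\<close> exists, so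
        the line is horizontal and agrees with the constant continuation of
        \<open>d\<close>.\<close>
      have "b = 0"
      proof (rule ccontr)
        assume "b \<noteq> 0"
        then obtain q where "q \<ge> x" "(b, q) \<in> G" using bp(3) by auto
        then show False using False by (force simp: R_def C_def)
      qed
      then show ?thesis using cl th0[OF False] by (simp add: d_def)
    qed
    then show ?thesis using \<open>b \<le> 0\<close> gl by blast
  qed
  have dc: "d x \<le> c x" if "x \<in> {0..1}" for x
    using line[OF that] that by auto
  have sub: "\<exists>b\<le>0. \<forall>y\<in>{0..1}. d x + b * (y - x) \<le> d y" if x: "x \<in> {0..1}" for x
  proof -
    obtain b g where b: "b \<le> 0" "\<And>y. y \<in> {0..1} \<Longrightarrow> g + b * y \<le> c y" "d x = g + b * x"
      using line[OF x] by blast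
    have "d x + b * (y - x) \<le> d y" if y: "y \<in> {0..1}" for y
    proof -
      have "d x + b * (y - x) = g + b * y" using b by (simp add: algebra_simps)
      \<comment> \<open>The weighted mean of \<open>l y\<close> and \<open>r y\<close> is at most
        \<open>y\<close>, and a line of nonpositive slope can only rise when moved to the
        left.\<close>
      also have "\<dots> \<le> g + b * ((1 - \<theta> y) * l y + \<theta> y * r y)"
        using mult_left_mono_neg[OF mean'[OF y] b(1)] by simp
      also have "\<dots> = (1 - \<theta> y) * (g + b * l y) + \<theta> y * (g + b * r y)" by (simp add: algebra_simps)
      also have "\<dots> \<le> d y"
        unfolding d_def using th01[OF y] b(2)[OF l01[OF y]] b(2)[OF r01[OF y]]
        by (intro add_mono mult_left_mono) auto
      finally show ?thesis .
    qed
    then show ?thesis using b(1) by blast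
  qed
  show thesis
    by (rule that[of l r \<theta> d]) (use l01 r01 th01 mean' sym dc sub in \<open>auto simp: d_def\<close>)
qed

section \<open>Concave functions as mixtures of kinks\<close>

text \<open>This is the negative of the usual second difference, so that concave sequences have
  nonnegative values. At \<open>j = n\<close> the sequence is continued as a constant, which makes
  the final increment count as a kink.\<close>

definition second_diff :: "nat \<Rightarrow> (nat \<Rightarrow> real) \<Rightarrow> nat \<Rightarrow> real" where
  "second_diff n f j = (f j - f (j - 1)) - (if j < n then f (j + 1) - f j else 0)"

text \<open>Summation by parts: the boundary term at \<open>0\<close> vanishes with
  \<open>g 0\<close>, and the one at \<open>n\<close> vanishes through the constant continuation in
  \<open>second_diff\<close>.\<close>

lemma sum_second_diff:
  assumes "g 0 = 0"
  shows "(\<Sum>j=1..n. second_diff n f j * g j) = (\<Sum>j=1..n. (f j - f (j - 1)) * (g j - g (j - 1)))"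
proof (cases n)
  case (Suc k)
  have "(\<Sum>j=1..n. (if j < n then f (j + 1) - f j else 0) * g j) = (\<Sum>j=1..k. (f (j + 1) - f j) * g j)"
    unfolding Suc by (simp add: sum.cl_ivl_Suc)
  also have "\<dots> = (\<Sum>j=0..k. (f (j + 1) - f j) * g j)"
    using assms by (simp add: sum.atLeast_Suc_atMost[of 0])
  also have "\<dots> = (\<Sum>j=1..n. (f j - f (j - 1)) * g (j - 1))"
    unfolding Suc One_nat_def by (subst sum.atLeast_Suc_atMost_Suc_shift) simp
  finally show ?thesis
    by (simp add: second_diff_def left_diff_distrib right_diff_distrib sum_subtractf)
qed simp

text \<open>The sum of products of increments is symmetric in \<open>f\<close> and \<open>g\<close>.
  This is the discrete form of integrating by parts twice.\<close>

lemma sum_second_diff_commute: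
  assumes "f 0 = 0" "g 0 = 0"
  shows "(\<Sum>j=1..n. second_diff n f j * g j) = (\<Sum>j=1..n. second_diff n g j * f j)"
  unfolding sum_second_diff[of g, OF assms(2)] sum_second_diff[of f, OF assms(1)] by (simp add: mult.commute)

section \<open>The cone of nondecreasing concave functions vanishing at 0\<close>

text \<open>These are the functions \<open>ubar - u\<close> with \<open>ubar\<close> affine of slope \<open>sh\<close> and \<open>u\<close> convex with slopes
  in \<open>[sh - K, sh]\<close> and \<open>u 0 = ubar 0\<close>.\<close>
definition conc :: "real \<Rightarrow> (real \<Rightarrow> real) set" where
  "conc K = {w. concave_on {0..1} w \<and> w 0 = 0 \<and>
     (\<forall>x\<in>{0..1}. \<forall>y\<in>{0..1}. x \<le> y \<longrightarrow> w x \<le> w y \<and> w y - w x \<le> K * (y - x))}"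

lemma concD:
  assumes "w \<in> conc K"
  shows "concave_on {0..1} w" "w 0 = 0"
    "\<And>x y. x \<in> {0..1} \<Longrightarrow> y \<in> {0..1} \<Longrightarrow> x \<le> y \<Longrightarrow> w x \<le> w y"
    "\<And>x y. x \<in> {0..1} \<Longrightarrow> y \<in> {0..1} \<Longrightarrow> x \<le> y \<Longrightarrow> w y - w x \<le> K * (y - x)"
  using assms unfolding conc_def by auto

lemma conc_lipschitz:
  assumes "w \<in> conc K" "x \<in> {0..1}" "y \<in> {0..1}"
  shows "\<bar>w x - w y\<bar> \<le> K * \<bar>x - y\<bar>"
proof (cases "x \<le> y")
  case True
  then show ?thesis using concD(3,4)[OF assms(1), of x y] assms by auto
next
  case False
  then show ?thesis using concD(3,4)[OF assms(1), of y x] assms by auto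
qed

lemma conc_nonneg: "w \<in> conc K \<Longrightarrow> 0 \<le> K"
  using concD(3,4)[of w K 0 1] by auto

lemma lipschitz_imp_continuous_on:
  fixes w :: "real \<Rightarrow> real"
  assumes "\<And>x y. x \<in> S \<Longrightarrow> y \<in> S \<Longrightarrow> \<bar>w x - w y\<bar> \<le> K * \<bar>x - y\<bar>"
  shows "continuous_on S w"
proof (rule lipschitz_on_continuous_on[of "max K 0"])
  show "(max K 0)-lipschitz_on S w"
  proof (rule lipschitz_onI)
    fix x y assume "x \<in> S" "y \<in> S"
    then have "\<bar>w x - w y\<bar> \<le> K * \<bar>x - y\<bar>" by (rule assms)
    also have "\<dots> \<le> max K 0 * \<bar>x - y\<bar>" by (intro mult_right_mono) auto
    finally show "dist (w x) (w y) \<le> max K 0 * dist x y" by (simp add: dist_real_def)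
  qed simp
qed

lemma conc_continuous: "w \<in> conc K \<Longrightarrow> continuous_on {0..1} w"
  by (rule lipschitz_imp_continuous_on[of _ _ K]) (rule conc_lipschitz)

lemma conc_limit:
  assumes "\<And>n. w n \<in> conc K" and lim: "\<And>x. x \<in> {0..1} \<Longrightarrow> (\<lambda>n. w n x) \<longlonglongrightarrow> v x"
  shows "v \<in> conc K"
  unfolding conc_def mem_Collect_eq
proof (intro conjI ballI impI)
  show "concave_on {0..1} v"
    unfolding concave_on_iff
  proof (intro conjI ballI allI impI)
    fix x y a b :: real
    assume *: "x \<in> {0..1}" "y \<in> {0..1}" "0 \<le> a" "0 \<le> b" "a + b = 1"
    then have z: "a *\<^sub>R x + b *\<^sub>R y \<in> {0..1}"
      by (intro convexD[OF convex_real_interval(5)]) auto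
    show "a * v x + b * v y \<le> v (a *\<^sub>R x + b *\<^sub>R y)"
    proof (rule tendsto_le[OF sequentially_bot lim[OF z]])
      show "(\<lambda>n. a * w n x + b * w n y) \<longlonglongrightarrow> a * v x + b * v y"
        using * by (intro tendsto_intros lim)
      show "\<forall>\<^sub>F n in sequentially. a * w n x + b * w n y \<le> w n (a *\<^sub>R x + b *\<^sub>R y)"
        using concD(1)[OF assms(1)] * unfolding concave_on_iff by (intro always_eventually) blast
    qed
  qed simp
  have "(\<lambda>n. w n 0) \<longlonglongrightarrow> v 0" by (rule lim) simp
  then show "v 0 = 0" using concD(2)[OF assms(1)] by (simp add: LIMSEQ_const_iff)
next
  fix x y :: real assume *: "x \<in> {0..1}" "y \<in> {0..1}" "x \<le> y"
  show "v x \<le> v y"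
    using concD(3)[OF assms(1) *] by (intro LIMSEQ_le[OF lim lim]) (use * in auto)
  have "(\<lambda>n. w n y - w n x) \<longlonglongrightarrow> v y - v x"
    using * by (intro tendsto_intros lim)
  then show "v y - v x \<le> K * (y - x)"
    using concD(4)[OF assms(1) *] by (intro LIMSEQ_le_const2) auto
qed

lemma concave_on_min_const: "concave_on {0..1} (\<lambda>x::real. min x t)"
  unfolding concave_on_iff
proof (intro conjI ballI allI impI)
  fix x y a b :: real
  assume *: "0 \<le> a" "0 \<le> b" "a + b = 1"
  have "a * min x t + b * min y t \<le> a * x + b * y"
    using * by (intro add_mono mult_left_mono) auto
  moreover have "a * min x t + b * min y t \<le> a * t + b * t"
    using * by (intro add_mono mult_left_mono) auto
  moreover have "a * t + b * t = t" using *(3) by (metis distrib_right mult_1)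
  ultimately show "a * min x t + b * min y t \<le> min (a *\<^sub>R x + b *\<^sub>R y) t" by simp
qed simp

lemma min_conc: "t \<in> {0..1} \<Longrightarrow> (\<lambda>x. min x t) \<in> conc 1"
  unfolding conc_def using concave_on_min_const by auto

lemma conc_scale:
  assumes "0 \<le> a" "w \<in> conc K"
  shows "(\<lambda>x. a * w x) \<in> conc (a * K)"
  unfolding conc_def mem_Collect_eq
proof (intro conjI ballI impI)
  show "concave_on {0..1} (\<lambda>x. a * w x)" using concD(1)[OF assms(2)] assms(1) by auto
  show "a * w 0 = 0" using concD(2)[OF assms(2)] by simp
next
  fix x y :: real assume *: "x \<in> {0..1}" "y \<in> {0..1}" "x \<le> y"
  show "a * w x \<le> a * w y" using concD(3)[OF assms(2) *] assms(1) by (rule mult_left_mono)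
  have "a * (w y - w x) \<le> a * (K * (y - x))" using concD(4)[OF assms(2) *] assms(1) by (rule mult_left_mono)
  then show "a * w y - a * w x \<le> a * K * (y - x)" by (simp add: algebra_simps)
qed

lemma conc_add:
  assumes "v \<in> conc K" "w \<in> conc K'"
  shows "(\<lambda>x. v x + w x) \<in> conc (K + K')"
  unfolding conc_def mem_Collect_eq
proof (intro conjI ballI impI)
  show "concave_on {0..1} (\<lambda>x. v x + w x)" using concD(1)[OF assms(1)] concD(1)[OF assms(2)] by (rule concave_on_add)
  show "v 0 + w 0 = 0" using concD(2)[OF assms(1)] concD(2)[OF assms(2)] by simp
next
  fix x y :: real assume *: "x \<in> {0..1}" "y \<in> {0..1}" "x \<le> y"
  show "v x + w x \<le> v y + w y" using concD(3)[OF assms(1) *] concD(3)[OF assms(2) *] by simp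
  show "v y + w y - (v x + w x) \<le> (K + K') * (y - x)"
    using concD(4)[OF assms(1) *] concD(4)[OF assms(2) *] by (simp add: distrib_right)
qed

lemma conc_mono:
  assumes "w \<in> conc K" "K \<le> K'"
  shows "w \<in> conc K'"
proof -
  have "w y - w x \<le> K' * (y - x)" if "x \<in> {0..1}" "y \<in> {0..1}" "x \<le> y" for x y
    using concD(4)[OF assms(1) that] mult_right_mono[OF assms(2), of "y - x"] that by linarith
  then show ?thesis using assms(1) unfolding conc_def by blast
qed

lemma conc_sum:
  assumes "finite I" "\<And>i. i \<in> I \<Longrightarrow> f i \<in> conc (k i)"
  shows "(\<lambda>x. \<Sum>i\<in>I. f i x) \<in> conc (\<Sum>i\<in>I. k i)"
  using assms
proof (induction I rule: finite_induct)
  case empty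
  then show ?case by (simp add: conc_def concave_on_const)
next
  case (insert i I)
  then show ?case using conc_add[of "f i" "k i" "\<lambda>x. \<Sum>i\<in>I. f i x"] by simp
qed

section \<open>Piecewise linear interpolation by kinks\<close>

text \<open>The drop in slope of the interpolant at the node \<open>j / n\<close>; the factor
  \<open>n\<close> turns increments into slopes. These weights are the discrete mixing
  measure.\<close>

definition kink_weight :: "(real \<Rightarrow> real) \<Rightarrow> nat \<Rightarrow> nat \<Rightarrow> real" where
  "kink_weight w n j = real n * second_diff n (\<lambda>i. w (real i / real n)) j"

definition interpolant :: "(real \<Rightarrow> real) \<Rightarrow> nat \<Rightarrow> real \<Rightarrow> real" where
  "interpolant w n x = (\<Sum>j=1..n. kink_weight w n j * min x (real j / real n))"

text \<open>For \<open>j < n\<close> this is midpoint concavity at three consecutive nodes. At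
  \<open>j = n\<close> only monotonicity is left, since the slope drops to \<open>0\<close>
  there.\<close>

lemma kink_weight_nonneg:
  assumes w: "w \<in> conc K" and j: "j \<in> {1..n}"
  shows "0 \<le> kink_weight w n j"
proof -
  have n: "n > 0" using j by auto
  have x: "real j / real n \<in> {0..1}" "real (j - 1) / real n \<in> {0..1}" using j by auto
  have m: "w (real (j - 1) / real n) \<le> w (real j / real n)"
    using concD(3)[OF w x(2,1)] by (simp add: divide_right_mono)
  have "w (real (j + 1) / real n) - w (real j / real n) \<le> w (real j / real n) - w (real (j - 1) / real n)" if "j < n"
  proof -
    have y: "real (j + 1) / real n \<in> {0..1}" using that by auto
    have eq: "(1/2) * (real (j - 1) / real n) + (1/2) * (real (j + 1) / real n) = real j / real n"
      using j n by (simp add: field_simps of_nat_diff)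
    have "(1/2) * w (real (j - 1) / real n) + (1/2) * w (real (j + 1) / real n)
        \<le> w ((1/2) *\<^sub>R (real (j - 1) / real n) + (1/2) *\<^sub>R (real (j + 1) / real n))"
      using concD(1)[OF w] x(2) y unfolding concave_on_iff
      by (metis half_gt_zero_iff less_eq_real_def zero_less_one field_sum_of_halves)
    then show ?thesis unfolding real_scaleR_def eq by simp
  qed
  then show ?thesis unfolding kink_weight_def second_diff_def using m by auto
qed

text \<open>Commuting the sum puts the second difference on \<open>j \<mapsto> min i j\<close>,
  where it is \<open>1\<close> at \<open>j = i\<close> and \<open>0\<close> elsewhere. For
  \<open>i = 0\<close> the value comes from \<open>w 0 = 0\<close>.\<close>

lemma interpolant_node:
  assumes "w 0 = 0" "i \<le> n" "n > 0"
  shows "interpolant w n (real i / real n) = w (real i / real n)"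
proof -
  have "interpolant w n (real i / real n)
      = (\<Sum>j=1..n. second_diff n (\<lambda>i. w (real i / real n)) j * real (min i j))"
    unfolding interpolant_def kink_weight_def using assms(3)
    by (intro sum.cong) (auto simp: min_def divide_le_cancel)
  also have "\<dots> = (\<Sum>j=1..n. second_diff n (\<lambda>j. real (min i j)) j * w (real j / real n))"
    by (rule sum_second_diff_commute) (use assms(1) in auto)
  also have "\<dots> = (\<Sum>j=1..n. if j = i then w (real j / real n) else 0)"
    using assms(2) by (intro sum.cong) (auto simp: second_diff_def min_def of_nat_diff)
  also have "\<dots> = w (real i / real n)"
    using assms by (cases "i = 0") auto
  finally show ?thesis .
qed

text \<open>All nodes are at least \<open>1 / n\<close>, so the total weight is the slope of the
  interpolant on its first cell, hence at most \<open>K\<close>. The factor \<open>1\<close> is the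
  slope bound of a single kink, as it arises from \<open>conc_scale\<close>.\<close>

lemma sum_kink_weight:
  assumes w: "w \<in> conc K" and n: "n > 0"
  shows "(\<Sum>j=1..n. kink_weight w n j * 1) \<le> K"
proof -
  have "w (1 / real n) - w 0 \<le> K * (1 / real n - 0)"
    using n by (intro concD(4)[OF w]) auto
  then have le: "w (1 / real n) \<le> K / real n" using concD(2)[OF w] by simp
  have "w (1 / real n) = (\<Sum>j=1..n. kink_weight w n j * min (1 / real n) (real j / real n))"
    using interpolant_node[of w 1 n] concD(2)[OF w] n by (simp add: interpolant_def)
  also have "\<dots> = (\<Sum>j=1..n. kink_weight w n j) / real n"
    unfolding sum_divide_distrib using n by (intro sum.cong) (auto simp: min_def divide_le_cancel)
  finally show ?thesis
    using n le by (simp add: divide_le_cancel)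
qed

lemma interpolant_conc:
  assumes w: "w \<in> conc K" and n: "n > 0"
  shows "interpolant w n \<in> conc K"
proof -
  have "(\<lambda>x. \<Sum>j=1..n. kink_weight w n j * min x (real j / real n)) \<in> conc (\<Sum>j=1..n. kink_weight w n j * 1)"
    by (intro conc_sum conc_scale kink_weight_nonneg[OF w] min_conc) auto
  then show ?thesis using sum_kink_weight[OF w n] unfolding interpolant_def[abs_def] by (rule conc_mono)
qed

text \<open>The two functions agree at the node \<open>i / n\<close> just left of \<open>x\<close>,
  and each changes by at most \<open>K / n\<close> between that node and \<open>x\<close>.\<close>

lemma interpolant_approx:
  assumes w: "w \<in> conc K" and n: "n > 0" and x: "x \<in> {0..1}"
  shows "\<bar>interpolant w n x - w x\<bar> \<le> 2 * K / real n"
proof -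
  define i where "i = nat \<lfloor>real n * x\<rfloor>"
  have i: "real i \<le> real n * x" "real n * x \<le> real i + 1"
    unfolding i_def using x by (auto simp: of_nat_nat intro: less_imp_le)
  have "real n * x \<le> real n" using x by (simp add: mult_left_le)
  then have "i \<le> n" using i(1) by linarith
  have ni: "real i / real n \<in> {0..1}" using \<open>i \<le> n\<close> n by simp
  have "x - real i / real n = (real n * x - real i) / real n" using n by (simp add: diff_divide_distrib)
  also have "\<bar>\<dots>\<bar> \<le> 1 / real n" using i unfolding abs_divide by (auto intro: divide_right_mono)
  finally have d: "\<bar>x - real i / real n\<bar> \<le> 1 / real n" .
  have "K * \<bar>x - real i / real n\<bar> \<le> K * (1 / real n)"
    using d conc_nonneg[OF w] by (rule mult_left_mono)
  then have "K * \<bar>x - real i / real n\<bar> \<le> K / real n" by simp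
  moreover have "2 * K / real n = K / real n + K / real n" by simp
  ultimately show ?thesis
    using conc_lipschitz[OF w x ni] conc_lipschitz[OF interpolant_conc[OF w n] x ni]
      interpolant_node[of w, OF concD(2)[OF w] \<open>i \<le> n\<close> n] by linarith
qed

section \<open>Ironing\<close>

text \<open>Linear functionals on continuous functions over \<open>{0..1}\<close>, bounded in the
  supremum norm. Keeping \<open>J\<close> abstract lets one argument serve both
  \<open>int_mu\<close> and its composition with the reflection.\<close>

locale bounded_functional =
  fixes J :: "(real \<Rightarrow> real) \<Rightarrow> real" and B :: real
  assumes lin: "continuous_on {0..1} f \<Longrightarrow> continuous_on {0..1} g \<Longrightarrow>
      J (\<lambda>x. a * f x + b * g x) = a * J f + b * J g"
    and bounded: "continuous_on {0..1} f \<Longrightarrow> (\<And>x. x \<in> {0..1} \<Longrightarrow> \<bar>f x\<bar> \<le> M) \<Longrightarrow> \<bar>J f\<bar> \<le> B * M"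
begin

lemma diff: "continuous_on {0..1} f \<Longrightarrow> continuous_on {0..1} g \<Longrightarrow> J (\<lambda>x. f x - g x) = J f - J g"
  using lin[of f g 1 "-1"] by simp

lemma diff_bound:
  assumes "continuous_on {0..1} f" "continuous_on {0..1} g" "\<And>x. x \<in> {0..1} \<Longrightarrow> \<bar>f x - g x\<bar> \<le> M"
  shows "\<bar>J f - J g\<bar> \<le> B * M"
  using bounded[of "\<lambda>x. f x - g x" M] diff[of f g] assms by (simp add: continuous_on_diff)

text \<open>The bound with \<open>M = 0\<close> applies to the difference of the two functions:
  values outside \<open>{0..1}\<close> do not affect \<open>J\<close>.\<close>

lemma cong:
  assumes "continuous_on {0..1} f" "\<And>x. x \<in> {0..1} \<Longrightarrow> f x = g x"
  shows "J f = J g"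
proof -
  have "continuous_on {0..1} g" using assms(1) continuous_on_cong[OF refl, of "{0..1}" f g] assms(2) by simp
  then show ?thesis using diff_bound[of f g 0] assms by simp
qed

lemma sum:
  assumes "finite I" "\<And>i. i \<in> I \<Longrightarrow> continuous_on {0..1} (f i)"
  shows "J (\<lambda>x. \<Sum>i\<in>I. a i * f i x) = (\<Sum>i\<in>I. a i * J (f i))"
  using assms
proof (induction I rule: finite_induct)
  case empty
  then show ?case using lin[of "\<lambda>_. 0" "\<lambda>_. 0" 0 0] by simp
next
  case (insert i I)
  have "continuous_on {0..1} (\<lambda>x. \<Sum>i\<in>I. a i * f i x)"
    using insert by (intro continuous_on_sum continuous_on_mult continuous_on_const) auto
  then show ?case using insert lin[of "f i" "\<lambda>x. \<Sum>i\<in>I. a i * f i x" "a i" 1] by simp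
qed

lemma limit:
  assumes "\<And>n. n > 0 \<Longrightarrow> continuous_on {0..1} (f n)" "continuous_on {0..1} g"
    and "\<And>n x. n > 0 \<Longrightarrow> x \<in> {0..1} \<Longrightarrow> \<bar>f n x - g x\<bar> \<le> M / real n"
  shows "(\<lambda>n. J (f n)) \<longlonglongrightarrow> J g"
proof (rule LIM_zero_cancel, rule Lim_null_comparison)
  show "\<forall>\<^sub>F n in sequentially. norm (J (f n) - J g) \<le> B * (M / real n)"
    using diff_bound[OF assms(1,2,3)] by (intro eventually_sequentiallyI[of 1]) auto
  show "(\<lambda>n. B * (M / real n)) \<longlonglongrightarrow> 0"
    using tendsto_mult_right_zero[OF lim_const_over_n[of M]] by simp
qed

end

section \<open>The ironing operator and its optimality properties\<close>

text \<open>The operator \<open>L\<close> of the overview, with \<open>l\<close>, \<open>r\<close>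
  and \<open>\<theta>\<close> supplied by the envelope.\<close>

definition ironed :: "(real \<Rightarrow> real) \<Rightarrow> (real \<Rightarrow> real) \<Rightarrow> (real \<Rightarrow> real) \<Rightarrow> (real \<Rightarrow> real) \<Rightarrow> real \<Rightarrow> real" where
  "ironed l r \<theta> w x = (1 - \<theta> x) * w (l x) + \<theta> x * w (r x)"

text \<open>For finite mixtures of kinks, the four properties reduce to facts about the kernel
  \<open>q\<close> and the envelope \<open>d\<close>; interpolation and continuity of
  \<open>J\<close> extend them to the cone. The parameters are chosen before \<open>w\<close>, which
  makes the operator linear.\<close>

lemma (in bounded_functional) ironing:
  obtains l r \<theta> where
    "\<And>w K. w \<in> conc K \<Longrightarrow> ironed l r \<theta> w \<in> conc K"
    "\<And>w K x. w \<in> conc K \<Longrightarrow> x \<in> {0..1} \<Longrightarrow> ironed l r \<theta> w x \<le> w x"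
    "\<And>w K. w \<in> conc K \<Longrightarrow> J (ironed l r \<theta> w) \<le> J w"
    "\<And>v w K. v \<in> conc K \<Longrightarrow> w \<in> conc K \<Longrightarrow> \<forall>x\<in>{0..1}. w x \<le> v x
      \<Longrightarrow> J (ironed l r \<theta> v) \<le> J (ironed l r \<theta> w)"
proof -
  define c where "c t = J (\<lambda>x. min x t)" for t
  have cont_min: "continuous_on {0..1} (\<lambda>x::real. min x t)" for t
    by (intro continuous_intros)
  have lip: "\<forall>x\<in>{0..1}. \<forall>y\<in>{0..1}. \<bar>c x - c y\<bar> \<le> B * \<bar>x - y\<bar>"
    unfolding c_def by (intro ballI diff_bound cont_min) (auto simp: min_def)
  have c0: "c 0 = 0"
    using cong[of "\<lambda>x. min x 0" "\<lambda>_. 0", OF cont_min] lin[of "\<lambda>_. 0" "\<lambda>_. 0" 0 0]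
    by (simp add: c_def)
  obtain l r \<theta> d :: "real \<Rightarrow> real" where
    l: "\<And>x. x \<in> {0..1} \<Longrightarrow> l x \<in> {0..1}" and
    r: "\<And>x. x \<in> {0..1} \<Longrightarrow> r x \<in> {0..1}" and
    th: "\<And>x. x \<in> {0..1} \<Longrightarrow> \<theta> x \<in> {0..1}" and
    mean: "\<And>x. x \<in> {0..1} \<Longrightarrow> (1 - \<theta> x) * l x + \<theta> x * r x \<le> x" and
    sym: "\<And>x t. x \<in> {0..1} \<Longrightarrow> t \<in> {0..1} \<Longrightarrow>
       (1 - \<theta> x) * min (l x) t + \<theta> x * min (r x) t = (1 - \<theta> t) * min (l t) x + \<theta> t * min (r t) x" and
    d: "\<And>x. d x = (1 - \<theta> x) * c (l x) + \<theta> x * c (r x)" and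
    dc: "\<And>x. x \<in> {0..1} \<Longrightarrow> d x \<le> c x" and
    sub: "\<And>x. x \<in> {0..1} \<Longrightarrow> \<exists>b\<le>0. \<forall>y\<in>{0..1}. d x + b * (y - x) \<le> d y"
    by (rule decreasing_convex_envelope[OF lip]) (rule that)
  \<comment> \<open>\<open>q t\<close> is the ironed kink at \<open>t\<close>. By symmetry of the
    kernel it is itself a mixture of the kinks at \<open>l t\<close> and \<open>r t\<close>, so it
    lies in the cone and \<open>J\<close> maps it to \<open>d t\<close>.\<close>
  define q where "q t x = (1 - \<theta> t) * min x (l t) + \<theta> t * min x (r t)" for t x
  have q_sym: "ironed l r \<theta> (\<lambda>x. min x t) x = q t x" if "x \<in> {0..1}" "t \<in> {0..1}" for x t
    using sym[OF that] by (simp add: ironed_def q_def min.commute)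
  have q_conc: "q t \<in> conc 1" if "t \<in> {0..1}" for t
  proof -
    have "(\<lambda>x. (1 - \<theta> t) * min x (l t) + \<theta> t * min x (r t)) \<in> conc ((1 - \<theta> t) * 1 + \<theta> t * 1)"
      using th[OF that] by (intro conc_add conc_scale min_conc l r that) auto
    then show ?thesis unfolding q_def[abs_def] by simp
  qed
  have J_q: "J (q t) = d t" for t
    unfolding q_def[abs_def] d c_def by (rule lin) (rule cont_min)+
  have q_le: "q t x \<le> min x t" if "x \<in> {0..1}" "t \<in> {0..1}" for x t
  proof -
    have "q t x \<le> (1 - \<theta> t) * x + \<theta> t * x" unfolding q_def
      using th[OF that(2)] by (intro add_mono mult_left_mono) auto
    moreover have "q t x \<le> (1 - \<theta> t) * l t + \<theta> t * r t" unfolding q_def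
      using th[OF that(2)] by (intro add_mono mult_left_mono) auto
    ultimately show ?thesis using mean[OF that(2)] by (simp add: algebra_simps)
  qed
  \<comment> \<open>On \<open>{0..1}\<close> this is the ironed interpolant, written as a mixture of
    the functions \<open>q t\<close>.\<close>
  define W where "W w n x = (\<Sum>j=1..n. kink_weight w n j * q (real j / real n) x)" for w n x
  have W_eq: "ironed l r \<theta> (interpolant w n) x = W w n x" if "x \<in> {0..1}" for w n x
  proof -
    have "ironed l r \<theta> (interpolant w n) x
      = (\<Sum>j=1..n. kink_weight w n j * ironed l r \<theta> (\<lambda>x. min x (real j / real n)) x)"
      unfolding ironed_def interpolant_def sum_distrib_left sum.distrib[symmetric]
      by (intro sum.cong) (auto simp: algebra_simps)
    also have "\<dots> = W w n x" unfolding W_def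
      by (intro sum.cong arg_cong2[where f="(*)"] q_sym that) auto
    finally show ?thesis .
  qed
  have close: "\<bar>W w n x - ironed l r \<theta> w x\<bar> \<le> (2 * K) / real n"
    if w: "w \<in> conc K" and n: "n > 0" and x: "x \<in> {0..1}" for w K n x
  proof -
    have "W w n x - ironed l r \<theta> w x
      = (1 - \<theta> x) * (interpolant w n (l x) - w (l x)) + \<theta> x * (interpolant w n (r x) - w (r x))"
      unfolding W_eq[OF x, symmetric] ironed_def by (simp add: algebra_simps)
    also have "\<bar>\<dots>\<bar> \<le> (1 - \<theta> x) * (2 * K / real n) + \<theta> x * (2 * K / real n)"
      using th[OF x] interpolant_approx[OF w n l[OF x]] interpolant_approx[OF w n r[OF x]]
      by (intro order.trans[OF abs_triangle_ineq] add_mono) (auto simp: abs_mult simp del: times_divide_eq_right intro: mult_left_mono)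
    also have "\<dots> = 2 * K / real n" by (simp only: distrib_right[symmetric]) simp
    finally show ?thesis .
  qed
  have W_conc: "W w n \<in> conc K" if w: "w \<in> conc K" and n: "n > 0" for w K n
  proof -
    have nK: "(\<Sum>j=1..n. kink_weight w n j * 1) \<le> K"
      by (rule sum_kink_weight[OF w n])
    have "(\<lambda>x. \<Sum>j=1..n. kink_weight w n j * q (real j / real n) x) \<in> conc (\<Sum>j=1..n. kink_weight w n j * 1)"
      by (intro conc_sum conc_scale kink_weight_nonneg[OF w] q_conc) auto
    then show ?thesis using nK unfolding W_def[abs_def] by (rule conc_mono)
  qed
  have lim0: "(\<lambda>n. f (Suc n)) \<longlonglongrightarrow> a"
    if "\<And>n. n > 0 \<Longrightarrow> \<bar>f n - a\<bar> \<le> M / real n" for f :: "nat \<Rightarrow> real" and a M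
  proof (rule LIMSEQ_Suc, rule LIM_zero_cancel, rule Lim_null_comparison[OF _ lim_const_over_n[of M]])
    show "\<forall>\<^sub>F n in sequentially. norm (f n - a) \<le> M / real n"
      using that by (intro eventually_sequentiallyI[of 1]) auto
  qed
  have I_conc: "ironed l r \<theta> w \<in> conc K" if w: "w \<in> conc K" for w K
    by (rule conc_limit[of "\<lambda>n. W w (Suc n)"]) (auto intro: W_conc[OF w] lim0[of "\<lambda>n. W w n _", OF close[OF w]])
  have I_le: "ironed l r \<theta> w x \<le> w x" if w: "w \<in> conc K" and x: "x \<in> {0..1}" for w K x
  proof (rule LIMSEQ_le)
    show "(\<lambda>n. W w (Suc n) x) \<longlonglongrightarrow> ironed l r \<theta> w x"
      by (rule lim0[of "\<lambda>n. W w n x", OF close[OF w _ x]])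
    show "(\<lambda>n. interpolant w (Suc n) x) \<longlonglongrightarrow> w x"
      by (rule lim0[of "\<lambda>n. interpolant w n x", OF interpolant_approx[OF w _ x]])
    have "W w n x \<le> interpolant w n x" for n
      unfolding W_def interpolant_def
      by (intro sum_mono mult_left_mono q_le kink_weight_nonneg[OF w] x) auto
    then show "\<exists>N. \<forall>n\<ge>N. W w (Suc n) x \<le> interpolant w (Suc n) x" by blast
  qed
  have J_W: "J (W w n) = (\<Sum>j=1..n. kink_weight w n j * d (real j / real n))" for w n
    unfolding W_def[abs_def] J_q[symmetric]
    by (rule sum) (auto intro: conc_continuous[OF q_conc])
  have J_int: "J (interpolant w n) = (\<Sum>j=1..n. kink_weight w n j * c (real j / real n))" for w n
    unfolding interpolant_def[abs_def] c_def by (rule sum) (auto intro: cont_min)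
  have J_lim: "(\<lambda>n. J (W w n)) \<longlonglongrightarrow> J (ironed l r \<theta> w)" if w: "w \<in> conc K" for w K
    by (rule limit[OF conc_continuous[OF W_conc[OF w]] conc_continuous[OF I_conc[OF w]] close[OF w]])
  have J_I_le: "J (ironed l r \<theta> w) \<le> J w" if w: "w \<in> conc K" for w K
  proof (rule LIMSEQ_le[OF J_lim[OF w]])
    show "(\<lambda>n. J (interpolant w n)) \<longlonglongrightarrow> J w"
      by (rule limit[OF conc_continuous[OF interpolant_conc[OF w]] conc_continuous[OF w] interpolant_approx[OF w]])
    have "J (W w n) \<le> J (interpolant w n)" for n
      unfolding J_W J_int by (intro sum_mono mult_left_mono dc kink_weight_nonneg[OF w]) auto
    then show "\<exists>N. \<forall>n\<ge>N. J (W w n) \<le> J (interpolant w n)" by blast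
  qed
  \<comment> \<open>At \<open>0\<close> each of \<open>l 0\<close> and \<open>r 0\<close> is either
    \<open>0\<close> or has weight \<open>0\<close>, and \<open>c 0 = 0\<close>. This is the
    boundary value for the summation by parts below.\<close>
  have d0: "d 0 = 0"
  proof -
    have 0: "(0::real) \<in> {0..1}" by simp
    have "0 \<le> (1 - \<theta> 0) * l 0" "0 \<le> \<theta> 0 * r 0" using l[OF 0] r[OF 0] th[OF 0] by auto
    then have "(1 - \<theta> 0) * l 0 = 0" "\<theta> 0 * r 0 = 0" using mean[OF 0] by linarith+
    then show ?thesis unfolding d using c0 by auto
  qed
  \<comment> \<open>For \<open>j < n\<close>, the subgradient inequality at the node is applied to
    both neighbours. At \<open>j = n\<close> the left neighbour and the sign of the slope
    suffice.\<close>
  have d_second: "second_diff n (\<lambda>i. d (real i / real n)) j \<le> 0" if j: "j \<in> {1..n}" for n j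
  proof -
    have n: "n > 0" using j by auto
    obtain b where b: "b \<le> 0" "\<And>y. y \<in> {0..1} \<Longrightarrow> d (real j / real n) + b * (y - real j / real n) \<le> d y"
      using sub[of "real j / real n"] j by auto
    have "real (j - 1) / real n - real j / real n = - (1 / real n)"
      using j n by (simp add: field_simps of_nat_diff)
    then have 1: "d (real j / real n) - b / real n \<le> d (real (j - 1) / real n)"
      using b(2)[of "real (j - 1) / real n"] j by auto
    have "real (j + 1) / real n - real j / real n = 1 / real n"
      using n by (simp add: field_simps)
    then have 2: "d (real j / real n) + b / real n \<le> d (real (j + 1) / real n)" if "j < n"
      using b(2)[of "real (j + 1) / real n"] that by auto
    have "b / real n \<le> 0" using b(1) by (simp add: divide_nonpos_nonneg)
    then show ?thesis unfolding second_diff_def using 1 2 by auto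
  qed
  have J_mono: "J (ironed l r \<theta> v) \<le> J (ironed l r \<theta> w)"
    if v: "v \<in> conc K" and w: "w \<in> conc K" and "\<forall>x\<in>{0..1}. w x \<le> v x" for v w K
  proof (rule LIMSEQ_le[OF J_lim[OF v] J_lim[OF w]])
    \<comment> \<open>Commuting the sum moves the second differences from \<open>u\<close> to
      \<open>d\<close>. Their nonpositive sign then turns a pointwise comparison of functions into
      the reversed comparison of values.\<close>
    have J_W': "J (W u n) = real n * (\<Sum>j=1..n. second_diff n (\<lambda>i. d (real i / real n)) j * u (real j / real n))"
      if "u \<in> conc K" for u n
      unfolding J_W kink_weight_def mult.assoc sum_distrib_left[symmetric]
      by (subst sum_second_diff_commute) (use d0 concD(2)[OF that] in auto)
    have "J (W v n) \<le> J (W w n)" for n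
      unfolding J_W'[OF v] J_W'[OF w]
      by (intro mult_left_mono sum_mono mult_left_mono_neg d_second bspec[OF that(3)]) auto
    then show "\<exists>N. \<forall>n\<ge>N. J (W v n) \<le> J (W w n)" by blast
  qed
  show thesis
    by (rule that[of l r \<theta>]) (use I_conc I_le J_I_le J_mono in blast)+
qed

section \<open>Convex function intervals\<close>

lemma interior_subgradient:
  assumes u: "convex_on {0..1} u" and x: "x \<in> {0<..<1::real}"
  obtains s where "s \<in> subdiffX u x"
proof -
  \<comment> \<open>The right derivative at \<open>x\<close>, as the infimum of the difference
    quotients to the right.\<close>
  define s where "s = Inf ((\<lambda>t. (u x - u t) / (x - t)) ` ({x<..} \<inter> {0..1}))"
  have "s \<in> subdiffX u x"
    unfolding subdiffX_def mem_Collect_eq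
  proof
    fix y :: real assume y: "y \<in> {0..1}"
    have "u y \<ge> u x + s * (y - x)"
      unfolding s_def using u x y by (intro convex_le_Inf_differential) auto
    then show "u x + s * (y - x) \<le> u y" .
  qed
  then show thesis by (rule that)
qed

lemma slopes_imp_lipschitz:
  fixes u :: "real \<Rightarrow> real"
  assumes S: "\<And>x y. x \<in> A \<Longrightarrow> y \<in> A \<Longrightarrow> x \<le> y \<Longrightarrow> sl * (y - x) \<le> u y - u x \<and> u y - u x \<le> sh * (y - x)"
    and xy: "x \<in> A" "y \<in> A"
  shows "\<bar>u x - u y\<bar> \<le> max \<bar>sl\<bar> \<bar>sh\<bar> * \<bar>x - y\<bar>"
proof -
  have *: "\<bar>u x - u y\<bar> \<le> max \<bar>sl\<bar> \<bar>sh\<bar> * \<bar>x - y\<bar>" if xy: "x \<in> A" "y \<in> A" "x \<le> y" for x y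
  proof -
    have "sh * (y - x) \<le> max \<bar>sl\<bar> \<bar>sh\<bar> * (y - x)" "(- sl) * (y - x) \<le> max \<bar>sl\<bar> \<bar>sh\<bar> * (y - x)"
      using xy by (intro mult_right_mono; auto)+
    then show ?thesis using S[OF xy] xy by (simp add: abs_le_iff)
  qed
  show ?thesis
    using *[OF xy] *[OF xy(2,1)] by (cases "x \<le> y") (simp_all add: abs_minus_commute)
qed

text \<open>Interior subgradients bound the increments between interior points, and continuity
  carries the bounds to the endpoints. Conversely, slope bounds give continuity and confine every
  interior subgradient. In this form the class is easily seen to be closed under limits, mixtures
  and reflection.\<close>

lemma KS_iff:
  "u \<in> KS ubar sl sh \<longleftrightarrow> convex_on {0..1} u \<and> (\<forall>x\<in>{0..1}. u x \<le> ubar x) \<and>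
     (\<forall>x\<in>{0..1}. \<forall>y\<in>{0..1}. x \<le> y \<longrightarrow> sl * (y - x) \<le> u y - u x \<and> u y - u x \<le> sh * (y - x))"
  (is "?L \<longleftrightarrow> ?C \<and> ?B \<and> ?S")
proof
  assume L: ?L
  then have c: ?C "continuous_on {0..1} u" and b: ?B
    and sd: "\<And>x. x \<in> {0<..<1} \<Longrightarrow> subdiffX u x \<subseteq> {sl..sh}"
    by (auto simp: KS_def KX_def)
  have int: "\<exists>s\<in>{sl..sh}. \<forall>y\<in>{0..1}. u x + s * (y - x) \<le> u y" if "x \<in> {0<..<1}" for x
    using interior_subgradient[OF c(1) that] sd[OF that] unfolding subdiffX_def by blast
  have interior_slopes: "u y - u x \<le> sh * (y - x) \<and> sl * (y - x) \<le> u y - u x"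
    if xy: "x \<in> {0<..<1}" "y \<in> {0<..<1}" "x \<le> y" for x y
  proof
    obtain s where "s \<in> {sl..sh}" "u y + s * (x - y) \<le> u x" using int[OF xy(2)] xy by fastforce
    moreover have "s * (y - x) \<le> sh * (y - x)" using \<open>s \<in> {sl..sh}\<close> xy by (intro mult_right_mono) auto
    ultimately show "u y - u x \<le> sh * (y - x)" by (simp add: algebra_simps)
    obtain s where "s \<in> {sl..sh}" "u x + s * (y - x) \<le> u y" using int[OF xy(1)] xy by fastforce
    moreover have "sl * (y - x) \<le> s * (y - x)" using \<open>s \<in> {sl..sh}\<close> xy by (intro mult_right_mono) auto
    ultimately show "sl * (y - x) \<le> u y - u x" by (simp add: algebra_simps)
  qed
  have ?S
  proof (intro ballI impI)
    fix x y :: real assume xy: "x \<in> {0..1}" "y \<in> {0..1}" "x \<le> y"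
    \<comment> \<open>The map \<open>p n\<close> contracts \<open>{0..1}\<close> towards
      \<open>1/2\<close> by a factor strictly between \<open>0\<close> and \<open>1\<close>. It
      preserves order, takes endpoints into the interior, and tends to the identity.\<close>
    define e where "e n = 1 / real (Suc (Suc n))" for n
    define p where "p n z = z + e n * (1/2 - z)" for n z
    have e: "0 < e n" "e n < 1" for n by (auto simp: e_def)
    have e_lim: "e \<longlonglongrightarrow> 0"
      unfolding e_def by (intro LIMSEQ_Suc lim_1_over_n)
    have p01: "p n z \<in> {0<..<1}" if "z \<in> {0..1}" for n z
    proof -
      have "0 \<le> (1 - e n) * z" "(1 - e n) * z \<le> (1 - e n) * 1"
        using that e[of n] by (auto intro!: mult_left_mono)
      then show ?thesis unfolding p_def using e[of n] by (simp add: algebra_simps)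
    qed
    have p_le: "p n x \<le> p n y" for n
      using mult_left_mono[OF xy(3), of "1 - e n"] e[of n] by (simp add: p_def algebra_simps)
    have lim: "(\<lambda>n. p n z) \<longlonglongrightarrow> z" for z
      unfolding p_def using tendsto_add[OF tendsto_const tendsto_mult_right[OF e_lim], of z "1/2 - z"] by simp
    have ulim: "(\<lambda>n. u (p n z)) \<longlonglongrightarrow> u z" if "z \<in> {0..1}" for z
      using p01[OF that]
      by (intro continuous_on_tendsto_compose[OF c(2) lim that] always_eventually) (auto intro: less_imp_le)
    have d: "(\<lambda>n. u (p n y) - u (p n x)) \<longlonglongrightarrow> u y - u x"
      by (intro tendsto_diff ulim xy)
    have k: "(\<lambda>n. k * (p n y - p n x)) \<longlonglongrightarrow> k * (y - x)" for k
      by (intro tendsto_intros lim)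
    show "sl * (y - x) \<le> u y - u x \<and> u y - u x \<le> sh * (y - x)"
      using LIMSEQ_le[OF k d] LIMSEQ_le[OF d k] interior_slopes[OF p01[OF xy(1)] p01[OF xy(2)] p_le] by blast
  qed
  with c b show "?C \<and> ?B \<and> ?S" by blast
next
  assume R: "?C \<and> ?B \<and> ?S"
  then have S: "sl * (y - x) \<le> u y - u x \<and> u y - u x \<le> sh * (y - x)"
    if "x \<in> {0..1}" "y \<in> {0..1}" "x \<le> y" for x y using that by blast
  have "continuous_on {0..1} u" by (rule lipschitz_imp_continuous_on, rule slopes_imp_lipschitz[OF S])
  moreover have "s \<in> {sl..sh}" if x: "x \<in> {0<..<1}" and s: "s \<in> subdiffX u x" for x s
  proof -
    have s: "u x + s * (y - x) \<le> u y" if "y \<in> {0..1}" for y using s that by (auto simp: subdiffX_def)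
    \<comment> \<open>Testing the subgradient at the endpoints squeezes it between the average
      slopes on the two sides of \<open>x\<close>.\<close>
    have "u 1 - u x \<le> sh * (1 - x)" "sl * (x - 0) \<le> u x - u 0" using S[of x 1] S[of 0 x] x by auto
    then have "s * (1 - x) \<le> sh * (1 - x)" "sl * x \<le> s * x"
      using s[of 1] s[of 0] by (auto simp: algebra_simps)
    then show ?thesis using x by auto
  qed
  ultimately show ?L using R by (auto simp: KS_def KX_def)
qed

lemma KS_continuous: "u \<in> KS ubar sl sh \<Longrightarrow> continuous_on {0..1} u"
  by (simp add: KS_def KX_def)

section \<open>Integration against the measure with density\<close>

lemma mult_continuous_integrable:
  fixes psi u :: "real \<Rightarrow> real"
  assumes "set_integrable lborel {0..1} psi" "continuous_on {0..1} u"
  shows "set_integrable lborel {0..1} (\<lambda>x. psi x * u x)"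
proof -
  obtain M where M: "\<And>x. x \<in> {0..1} \<Longrightarrow> norm (u x) \<le> M"
    using compact_imp_bounded[OF compact_continuous_image[OF assms(2) compact_Icc]]
    unfolding bounded_iff by blast
  have [measurable]: "(\<lambda>x. indicator {0..1} x * u x) \<in> borel_measurable borel"
    using borel_measurable_continuous_on_indicator[OF _ assms(2)] by simp
  have [measurable]: "(\<lambda>x. indicator {0..1} x * psi x) \<in> borel_measurable lborel"
    using assms(1) unfolding set_integrable_def by (auto dest: borel_measurable_integrable)
  \<comment> \<open>Both factors receive the indicator because their measurability is known only on
    \<open>{0..1}\<close>.\<close>
  have eq: "indicator {0..1} x * (psi x * u x) = (indicator {0..1} x * psi x) * (indicator {0..1} x * u x)" for x
    by (simp add: indicator_def)
  show ?thesis unfolding set_integrable_def real_scaleR_def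
  proof (rule Bochner_Integration.integrable_bound)
    show "integrable lborel (\<lambda>x. M * (indicator {0..1} x * psi x))"
      using assms(1) unfolding set_integrable_def by (intro integrable_mult_right) simp
    show "(\<lambda>x. indicator {0..1} x * (psi x * u x)) \<in> borel_measurable lborel"
      unfolding eq by measurable
    have "norm (indicator {0..1} x * (psi x * u x)) \<le> norm (M * (indicator {0..1} x * psi x))" for x
    proof (cases "x \<in> {0..1}")
      case True
      have "\<bar>u x\<bar> \<le> \<bar>M\<bar>" using M[OF True] by auto
      then have "\<bar>psi x\<bar> * \<bar>u x\<bar> \<le> \<bar>psi x\<bar> * \<bar>M\<bar>" by (intro mult_left_mono) auto
      then show ?thesis using True by (simp add: abs_mult mult.commute)
    qed simp
    then show "AE x in lborel. norm (indicator {0..1} x * (psi x * u x)) \<le> norm (M * (indicator {0..1} x * psi x))"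
      by simp
  qed
qed

text \<open>The constant is the integral of the absolute density against the sum of Lebesgue measure
  and the unit masses at the two endpoints.\<close>

lemma int_mu_bounded_functional:
  assumes psi: "set_integrable lborel {0..1} psi"
  shows "bounded_functional (int_mu psi) (\<bar>psi 1\<bar> + \<bar>psi 0\<bar> + (LBINT x:{0..1}. \<bar>psi x\<bar>))"
proof
  fix f g :: "real \<Rightarrow> real" and a b :: real
  assume f: "continuous_on {0..1} f" and g: "continuous_on {0..1} g"
  note i = mult_continuous_integrable[OF psi f] mult_continuous_integrable[OF psi g]
  have "(LBINT x:{0..1}. psi x * (a * f x + b * g x)) = (LBINT x:{0..1}. a * (psi x * f x) + b * (psi x * g x))"
    by (intro set_lebesgue_integral_cong) (auto simp: algebra_simps)
  also have "\<dots> = a * (LBINT x:{0..1}. psi x * f x) + b * (LBINT x:{0..1}. psi x * g x)"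
    using i by (simp add: set_integral_add)
  finally show "int_mu psi (\<lambda>x. a * f x + b * g x) = a * int_mu psi f + b * int_mu psi g"
    unfolding int_mu_def by (simp add: algebra_simps)
next
  fix f :: "real \<Rightarrow> real" and M :: real
  assume f: "continuous_on {0..1} f" and M: "\<And>x. x \<in> {0..1} \<Longrightarrow> \<bar>f x\<bar> \<le> M"
  have ai: "set_integrable lborel {0..1} (\<lambda>x. \<bar>psi x\<bar>)" using psi by (rule set_integrable_abs)
  have "\<bar>LBINT x:{0..1}. psi x * f x\<bar> \<le> (LBINT x:{0..1}. \<bar>psi x * f x\<bar>)"
    using set_integral_norm_bound[OF mult_continuous_integrable[OF psi f]] by simp
  also have "\<dots> \<le> (LBINT x:{0..1}. M * \<bar>psi x\<bar>)"
  proof (rule set_integral_mono)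
    show "set_integrable lborel {0..1} (\<lambda>x. \<bar>psi x * f x\<bar>)"
      by (intro set_integrable_abs mult_continuous_integrable psi f)
    show "set_integrable lborel {0..1} (\<lambda>x. M * \<bar>psi x\<bar>)" using ai by simp
    show "\<bar>psi x * f x\<bar> \<le> M * \<bar>psi x\<bar>" if "x \<in> {0..1}" for x
      using mult_right_mono[OF M[OF that], of "\<bar>psi x\<bar>"] by (simp add: abs_mult mult.commute)
  qed
  finally have "\<bar>LBINT x:{0..1}. psi x * f x\<bar> \<le> M * (LBINT x:{0..1}. \<bar>psi x\<bar>)" by simp
  moreover have "\<bar>psi 1 * f 1\<bar> \<le> M * \<bar>psi 1\<bar>" "\<bar>psi 0 * f 0\<bar> \<le> M * \<bar>psi 0\<bar>"
    using mult_right_mono[OF M[of 1], of "\<bar>psi 1\<bar>"] mult_right_mono[OF M[of 0], of "\<bar>psi 0\<bar>"]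
    by (simp_all add: abs_mult mult.commute)
  ultimately show "\<bar>int_mu psi f\<bar> \<le> (\<bar>psi 1\<bar> + \<bar>psi 0\<bar> + (LBINT x:{0..1}. \<bar>psi x\<bar>)) * M"
    unfolding int_mu_def by (simp add: algebra_simps abs_le_iff)
qed

lemma (in bounded_functional) reflection:
  "bounded_functional (\<lambda>f. J (\<lambda>x. f (1 - x))) B"
proof
  have refl: "continuous_on {0..1} (\<lambda>x. f (1 - x))" if "continuous_on {0..1} f" for f :: "real \<Rightarrow> real"
    by (rule continuous_on_compose2[OF that]) (auto intro!: continuous_intros)
  show "J (\<lambda>x. a * f (1 - x) + b * g (1 - x)) = a * J (\<lambda>x. f (1 - x)) + b * J (\<lambda>x. g (1 - x))"
    if "continuous_on {0..1} f" "continuous_on {0..1} g" for f g a b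
    by (intro lin refl that)
  show "\<bar>J (\<lambda>x. f (1 - x))\<bar> \<le> B * M"
    if "continuous_on {0..1} f" "\<And>x. x \<in> {0..1} \<Longrightarrow> \<bar>f x\<bar> \<le> M" for f M
    by (intro bounded refl that) auto
qed

section \<open>Limits and mixtures of convex functions with bounded slopes\<close>

lemma KS_D:
  assumes "u \<in> KS ubar sl sh"
  shows "convex_on {0..1} u" "\<And>x. x \<in> {0..1} \<Longrightarrow> u x \<le> ubar x"
    "\<And>x y. x \<in> {0..1} \<Longrightarrow> y \<in> {0..1} \<Longrightarrow> x \<le> y \<Longrightarrow>
       sl * (y - x) \<le> u y - u x \<and> u y - u x \<le> sh * (y - x)"
  using assms unfolding KS_iff by blast+

lemma KS_I:
  assumes "\<And>x y a b. x \<in> {0..1} \<Longrightarrow> y \<in> {0..1} \<Longrightarrow> 0 \<le> a \<Longrightarrow> 0 \<le> b \<Longrightarrow> a + b = 1 \<Longrightarrow>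
      u (a * x + b * y) \<le> a * u x + b * u y"
    and "\<And>x. x \<in> {0..1} \<Longrightarrow> u x \<le> ubar x"
    and "\<And>x y. x \<in> {0..1} \<Longrightarrow> y \<in> {0..1} \<Longrightarrow> x \<le> y \<Longrightarrow>
       sl * (y - x) \<le> u y - u x \<and> u y - u x \<le> sh * (y - x)"
  shows "u \<in> KS ubar sl sh"
  using assms unfolding KS_iff convex_on_def by simp

lemma convex_on_realD:
  fixes u :: "real \<Rightarrow> real"
  assumes "convex_on A u" "x \<in> A" "y \<in> A" "0 \<le> a" "0 \<le> b" "a + b = 1"
  shows "u (a * x + b * y) \<le> a * u x + b * u y"
  using assms unfolding convex_on_def by auto

lemma mix_in_Icc:
  assumes "x \<in> {0..1::real}" "y \<in> {0..1}" "0 \<le> a" "0 \<le> b" "a + b = 1"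
  shows "a * x + b * y \<in> {0..1}"
  using convexD[OF convex_real_interval(5)[of 0 1] assms] by simp

lemma KS_limit:
  assumes u: "\<And>n. u n \<in> KS ubar sl sh" and lim: "\<And>x. x \<in> {0..1} \<Longrightarrow> (\<lambda>n. u n x) \<longlonglongrightarrow> v x"
  shows "v \<in> KS ubar sl sh"
proof (rule KS_I)
  fix x y a b :: real
  assume *: "x \<in> {0..1}" "y \<in> {0..1}" "0 \<le> a" "0 \<le> b" "a + b = 1"
  have "(\<lambda>n. a * u n x + b * u n y) \<longlonglongrightarrow> a * v x + b * v y"
    using * by (intro tendsto_intros lim)
  then show "v (a * x + b * y) \<le> a * v x + b * v y"
    using convex_on_realD[OF KS_D(1)[OF u] *] by (intro LIMSEQ_le[OF lim[OF mix_in_Icc[OF *]]]) auto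
next
  fix x :: real assume "x \<in> {0..1}"
  then show "v x \<le> ubar x" using KS_D(2)[OF u] by (intro LIMSEQ_le_const2[OF lim]) auto
next
  fix x y :: real assume *: "x \<in> {0..1}" "y \<in> {0..1}" "x \<le> y"
  have d: "(\<lambda>n. u n y - u n x) \<longlonglongrightarrow> v y - v x"
    using * by (intro tendsto_intros lim)
  show "sl * (y - x) \<le> v y - v x \<and> v y - v x \<le> sh * (y - x)"
    using LIMSEQ_le_const[OF d] LIMSEQ_le_const2[OF d] KS_D(3)[OF u *] by blast
qed

lemma KS_mix:
  assumes u: "u \<in> KS ubar sl sh" and v: "v \<in> KS ubar sl sh" and c: "c \<in> {0..1}"
  shows "(\<lambda>y. c * u y + (1 - c) * v y) \<in> KS ubar sl sh"
proof (rule KS_I)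
  fix x y a b :: real
  assume *: "x \<in> {0..1}" "y \<in> {0..1}" "0 \<le> a" "0 \<le> b" "a + b = 1"
  have "c * u (a * x + b * y) + (1 - c) * v (a * x + b * y)
      \<le> c * (a * u x + b * u y) + (1 - c) * (a * v x + b * v y)"
    using c convex_on_realD[OF KS_D(1)[OF u] *] convex_on_realD[OF KS_D(1)[OF v] *]
    by (intro add_mono mult_left_mono) auto
  then show "c * u (a * x + b * y) + (1 - c) * v (a * x + b * y)
      \<le> a * (c * u x + (1 - c) * v x) + b * (c * u y + (1 - c) * v y)"
    by (simp add: algebra_simps)
next
  fix x :: real assume x: "x \<in> {0..1}"
  have "c * u x + (1 - c) * v x \<le> c * ubar x + (1 - c) * ubar x"
    using c KS_D(2)[OF u x] KS_D(2)[OF v x] by (intro add_mono mult_left_mono) auto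
  then show "c * u x + (1 - c) * v x \<le> ubar x" by (simp add: algebra_simps)
next
  fix x y :: real assume *: "x \<in> {0..1}" "y \<in> {0..1}" "x \<le> y"
  have "c * (sl * (y - x)) + (1 - c) * (sl * (y - x)) \<le> c * (u y - u x) + (1 - c) * (v y - v x)"
    "c * (u y - u x) + (1 - c) * (v y - v x) \<le> c * (sh * (y - x)) + (1 - c) * (sh * (y - x))"
    using c KS_D(3)[OF u *] KS_D(3)[OF v *] by (intro add_mono mult_left_mono; simp)+
  then show "sl * (y - x) \<le> c * u y + (1 - c) * v y - (c * u x + (1 - c) * v x)
      \<and> c * u y + (1 - c) * v y - (c * u x + (1 - c) * v x) \<le> sh * (y - x)"
    by (simp add: algebra_simps)
qed

lemma Uint_mix:
  assumes "u \<in> Uint ubar sl sh ul1" "v \<in> Uint ubar sl sh ul2" "c \<in> {0..1}"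
  shows "(\<lambda>y. c * u y + (1 - c) * v y) \<in> Uint ubar sl sh (\<lambda>y. c * ul1 y + (1 - c) * ul2 y)"
  using assms KS_mix unfolding Uint_def by (auto intro!: add_mono mult_left_mono)

section \<open>Existence of maximisers and concavity of the value\<close>

lemma Uint_bounded:
  assumes "continuous_on {0..1} ubar" "continuous_on {0..1} ul"
  obtains M where "\<And>u x. u \<in> Uint ubar sl sh ul \<Longrightarrow> x \<in> {0..1} \<Longrightarrow> \<bar>u x\<bar> \<le> M"
proof -
  have "\<exists>M. \<forall>x\<in>{0..1}. \<bar>f x\<bar> \<le> M" if "continuous_on {0..1} f" for f :: "real \<Rightarrow> real"
    using compact_imp_bounded[OF compact_continuous_image[OF that compact_Icc]]
    unfolding bounded_iff by auto
  then obtain M1 M2 where M: "\<And>x. x \<in> {0..1} \<Longrightarrow> \<bar>ubar x\<bar> \<le> M1" "\<And>x. x \<in> {0..1} \<Longrightarrow> \<bar>ul x\<bar> \<le> M2"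
    using assms by meson
  have "\<bar>u x\<bar> \<le> max M1 M2" if u: "u \<in> Uint ubar sl sh ul" and x: "x \<in> {0..1}" for u x
  proof -
    have "ul x \<le> u x" "u x \<le> ubar x" using u x KS_D(2)[of u] by (auto simp: Uint_def)
    then show ?thesis using M[OF x] by linarith
  qed
  then show thesis by (rule that)
qed

lemma (in bounded_functional) Uint_bdd_above:
  assumes "continuous_on {0..1} ubar" "continuous_on {0..1} ul"
  shows "bdd_above (J ` Uint ubar sl sh ul)"
proof -
  obtain M where M: "\<And>u x. u \<in> Uint ubar sl sh ul \<Longrightarrow> x \<in> {0..1} \<Longrightarrow> \<bar>u x\<bar> \<le> M"
    using Uint_bounded[OF assms] by metis
  have "J u \<le> B * M" if u: "u \<in> Uint ubar sl sh ul" for u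
  proof -
    have "u \<in> KS ubar sl sh" using u by (simp add: Uint_def)
    then have "\<bar>J u\<bar> \<le> B * M" using M[OF u] by (intro bounded KS_continuous)
    then show ?thesis by simp
  qed
  then show ?thesis by (rule bdd_aboveI2)
qed

text \<open>A maximising sequence is uniformly bounded and uniformly Lipschitz, so Arzela-Ascoli
  gives a uniformly convergent subsequence. Its limit is feasible because the constraints are
  pointwise closed, and it attains the supremum because \<open>J\<close> is continuous.\<close>

lemma (in bounded_functional) Uint_max:
  assumes ubar: "continuous_on {0..1} ubar" and ul: "ul \<in> KS ubar sl sh"
  obtains u where "u \<in> Uint ubar sl sh ul" "\<And>w. w \<in> Uint ubar sl sh ul \<Longrightarrow> J w \<le> J u"
proof -
  let ?U = "Uint ubar sl sh ul"
  note bdd = Uint_bdd_above[OF ubar KS_continuous[OF ul], of sl sh]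
  have "ul \<in> ?U" using ul by (simp add: Uint_def)
  have UK: "u \<in> KS ubar sl sh" if "u \<in> ?U" for u using that by (simp add: Uint_def)
  have "\<exists>u\<in>?U. Sup (J ` ?U) - 1 / real (Suc n) < J u" for n
    using less_cSup_iff[OF _ bdd, of "Sup (J ` ?U) - 1 / real (Suc n)"] \<open>ul \<in> ?U\<close> by auto
  then obtain u where u: "\<And>n. u n \<in> ?U" "\<And>n. Sup (J ` ?U) - 1 / real (Suc n) < J (u n)"
    by metis
  obtain M where M: "\<And>u x. u \<in> ?U \<Longrightarrow> x \<in> {0..1} \<Longrightarrow> \<bar>u x\<bar> \<le> M"
    using Uint_bounded[OF ubar KS_continuous[OF ul]] by metis
  \<comment> \<open>The added \<open>1\<close> makes \<open>K\<close> positive, so that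
    \<open>e / K\<close> can serve as the modulus of equicontinuity.\<close>
  define K where "K = max \<bar>sl\<bar> \<bar>sh\<bar> + 1"
  have "0 < K" by (simp add: K_def)
  have lip: "\<bar>u n x - u n y\<bar> \<le> K * \<bar>x - y\<bar>" if "x \<in> {0..1}" "y \<in> {0..1}" for n x y
  proof -
    have "\<bar>u n x - u n y\<bar> \<le> max \<bar>sl\<bar> \<bar>sh\<bar> * \<bar>x - y\<bar>"
      by (rule slopes_imp_lipschitz[OF KS_D(3)[OF UK[OF u(1)]] that])
    then show ?thesis unfolding K_def distrib_right using abs_ge_zero[of "x - y"] by linarith
  qed
  have equi: "\<exists>d. 0 < d \<and> (\<forall>n y. y \<in> {0..1} \<and> norm (x - y) < d \<longrightarrow> norm (u n x - u n y) < e)"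
    if x: "x \<in> {0..1}" and e: "0 < e" for x e :: real
  proof (intro exI[of _ "e / K"] conjI allI impI)
    show "0 < e / K" using e \<open>0 < K\<close> by simp
    fix n y assume y: "y \<in> {0..1} \<and> norm (x - y) < e / K"
    then have "K * \<bar>x - y\<bar> < e" using \<open>0 < K\<close> by (simp add: pos_less_divide_eq mult.commute)
    then show "norm (u n x - u n y) < e" using lip[OF x, of y n] y by simp
  qed
  have norm_le: "norm (u n x) \<le> M" if "x \<in> {0..1}" for n x using M[OF u(1) that] by simp
  obtain g k where g: "continuous_on {0..1} g" "strict_mono (k :: nat \<Rightarrow> nat)"
    and unif: "\<And>e. 0 < e \<Longrightarrow> \<exists>N. \<forall>n x. n \<ge> N \<and> x \<in> {0..1} \<longrightarrow> norm (u (k n) x - g x) < e"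
    using Arzela_Ascoli[of "{0..1::real}" u M, OF compact_Icc norm_le equi] by blast
  have pt: "(\<lambda>n. u (k n) x) \<longlonglongrightarrow> g x" if "x \<in> {0..1}" for x
    unfolding LIMSEQ_iff using unif that by blast
  have gU: "g \<in> ?U"
    using KS_limit[of "\<lambda>n. u (k n)", OF UK[OF u(1)] pt] u(1) LIMSEQ_le_const[OF pt]
    unfolding Uint_def by blast
  have "(\<lambda>n. J (u (k n))) \<longlonglongrightarrow> J g"
    unfolding LIMSEQ_iff
  proof (intro allI impI)
    fix e :: real assume e: "0 < e"
    \<comment> \<open>The denominator \<open>\<bar>B\<bar> + 1\<close> is positive and strictly
      exceeds \<open>B\<close>, which gives the strict final bound.\<close>
    have "0 < e / (\<bar>B\<bar> + 1)" using e by simp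
    from unif[OF this] obtain N where
      N: "\<And>n x. n \<ge> N \<Longrightarrow> x \<in> {0..1} \<Longrightarrow> \<bar>u (k n) x - g x\<bar> < e / (\<bar>B\<bar> + 1)" by auto
    have "\<bar>J (u (k n)) - J g\<bar> < e" if "n \<ge> N" for n
    proof -
      have "\<bar>J (u (k n)) - J g\<bar> \<le> B * (e / (\<bar>B\<bar> + 1))"
        using N[OF that] by (intro diff_bound KS_continuous[OF UK[OF u(1)]] g(1)) (auto intro: less_imp_le)
      also have "\<dots> < (\<bar>B\<bar> + 1) * (e / (\<bar>B\<bar> + 1))"
        using e by (intro mult_strict_right_mono) auto
      finally show ?thesis by simp
    qed
    then show "\<exists>N. \<forall>n\<ge>N. norm (J (u (k n)) - J g) < e" by auto
  qed
  moreover have "(\<lambda>n. Sup (J ` ?U) - 1 / real (Suc n)) \<longlonglongrightarrow> Sup (J ` ?U) - 0"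
    by (intro tendsto_diff tendsto_const LIMSEQ_Suc lim_1_over_n)
  moreover have "Sup (J ` ?U) - 1 / real (Suc n) \<le> J (u (k n))" for n
  proof -
    have "1 / real (Suc (k n)) \<le> 1 / real (Suc n)"
      using seq_suble[OF g(2), of n] by (intro divide_left_mono) auto
    then show ?thesis using u(2)[of "k n"] by linarith
  qed
  ultimately have "Sup (J ` ?U) \<le> J g" by (intro LIMSEQ_le[of _ "Sup (J ` ?U)" _ "J g"]) auto
  moreover have "J w \<le> Sup (J ` ?U)" if "w \<in> ?U" for w
    using that bdd by (intro cSup_upper) auto
  ultimately show thesis using that[OF gU] by force
qed

lemma (in bounded_functional) Sup_Uint_concave:
  assumes ubar: "continuous_on {0..1} ubar" and ul: "ul1 \<in> KS ubar sl sh" "ul2 \<in> KS ubar sl sh"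
    and a: "a \<in> {0..1}"
  shows "a * Sup (J ` Uint ubar sl sh ul1) + (1 - a) * Sup (J ` Uint ubar sl sh ul2)
    \<le> Sup (J ` Uint ubar sl sh (\<lambda>y. a * ul1 y + (1 - a) * ul2 y))"
proof -
  obtain u where u: "u \<in> Uint ubar sl sh ul1" "\<And>w. w \<in> Uint ubar sl sh ul1 \<Longrightarrow> J w \<le> J u"
    using Uint_max[OF ubar ul(1)] by metis
  obtain v where v: "v \<in> Uint ubar sl sh ul2" "\<And>w. w \<in> Uint ubar sl sh ul2 \<Longrightarrow> J w \<le> J v"
    using Uint_max[OF ubar ul(2)] by metis
  have "Sup (J ` Uint ubar sl sh ul1) = J u" "Sup (J ` Uint ubar sl sh ul2) = J v"
    using u v by (auto intro!: cSup_eq_maximum)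
  moreover have "J (\<lambda>y. a * u y + (1 - a) * v y) = a * J u + (1 - a) * J v"
    using u v by (intro lin) (auto simp: Uint_def intro: KS_continuous)
  moreover have "J (\<lambda>y. a * u y + (1 - a) * v y) \<le> Sup (J ` Uint ubar sl sh (\<lambda>y. a * ul1 y + (1 - a) * ul2 y))"
    by (intro cSup_upper imageI Uint_mix u v a Uint_bdd_above ubar KS_continuous[OF KS_mix[OF ul a]])
  ultimately show ?thesis by simp
qed

section \<open>Integrals against the signed measure\<close>

lemma finite_measure_continuous_integrable:
  fixes f :: "real \<Rightarrow> real"
  assumes "finite_measure M" "sets M = sets borel" "continuous_on {0..1} f"
  shows "set_integrable M {0..1} f"
proof -
  interpret finite_measure M by fact
  obtain C where C: "\<And>x. x \<in> {0..1} \<Longrightarrow> norm (f x) \<le> C"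
    using compact_imp_bounded[OF compact_continuous_image[OF assms(3) compact_Icc]]
    unfolding bounded_iff by blast
  have "0 \<le> C" using C[of 0] by (auto intro: order.trans[OF norm_ge_zero])
  show ?thesis unfolding set_integrable_def
  proof (rule integrable_const_bound[of _ C])
    show "AE x in M. norm (indicat_real {0..1} x *\<^sub>R f x) \<le> C"
      using C \<open>0 \<le> C\<close> by (auto simp: indicator_def)
    show "(\<lambda>x. indicat_real {0..1} x *\<^sub>R f x) \<in> borel_measurable M"
      using borel_measurable_continuous_on_indicator[OF _ assms(3)] assms(2)
      by (simp add: measurable_cong_sets[OF assms(2) refl])
  qed
qed

lemma int_signed_mix:
  assumes nup: "finite_measure nup" "sets nup = sets borel"
    and nun: "finite_measure nun" "sets nun = sets borel"
    and f: "continuous_on {0..1} f" and g: "continuous_on {0..1} g"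
    and eq: "\<And>x. x \<in> {0..1} \<Longrightarrow> h x = a * f x + b * g x"
  shows "int_signed nup nun h = a * int_signed nup nun f + b * int_signed nup nun g"
proof -
  have "set_lebesgue_integral M {0..1} h = a * set_lebesgue_integral M {0..1} f + b * set_lebesgue_integral M {0..1} g"
    if M: "finite_measure M" "sets M = sets borel" for M
  proof -
    have "set_lebesgue_integral M {0..1} h = set_lebesgue_integral M {0..1} (\<lambda>x. a * f x + b * g x)"
      using eq M(2) by (intro set_lebesgue_integral_cong) auto
    also have "\<dots> = a * set_lebesgue_integral M {0..1} f + b * set_lebesgue_integral M {0..1} g"
      using finite_measure_continuous_integrable[OF M f] finite_measure_continuous_integrable[OF M g]
      by (simp add: set_integral_add)
    finally show ?thesis .
  qed
  from this[OF nup] this[OF nun] show ?thesis unfolding int_signed_def by (simp add: algebra_simps)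
qed

section \<open>Linear selections from ironing\<close>

text \<open>A common form of the two affine cases: the involution \<open>\<phi>\<close> is the
  identity for slope \<open>sh\<close> and the reflection for slope \<open>sl\<close>. In the
  reflected coordinate, the gap below \<open>ubar\<close> ranges exactly over the cone.\<close>

lemma linear_selection:
  assumes psi: "set_integrable lborel {0..1} psi"
    and nup: "finite_measure nup" "sets nup = sets borel"
    and nun: "finite_measure nun" "sets nun = sets borel"
    and ubar: "continuous_on {0..1} ubar"
    and phi: "\<And>x. x \<in> {0..1} \<Longrightarrow> \<phi> x \<in> {0..1}" "\<And>x. \<phi> (\<phi> x) = x"
    and J: "bounded_functional (\<lambda>f. int_mu psi (\<lambda>x. f (\<phi> x))) B"
    and D: "\<And>u. u \<in> D \<longleftrightarrow> (\<lambda>x. ubar (\<phi> x) - u (\<phi> x)) \<in> conc K"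
    and D_KS: "D \<subseteq> KS ubar sl sh"
    and D_up: "\<And>ul u. ul \<in> D \<Longrightarrow> u \<in> Uint ubar sl sh ul \<Longrightarrow> u \<in> D"
  shows "\<exists>sel. linear_argmax_selection ubar sl sh psi D sel \<and>
          (\<forall>ul1\<in>D. \<forall>ul2\<in>D. \<forall>a\<in>{0..1::real}.
             int_signed nup nun (sel (\<lambda>y. a * ul1 y + (1 - a) * ul2 y))
             = a * int_signed nup nun (sel ul1) + (1 - a) * int_signed nup nun (sel ul2))"
proof -
  interpret mu: bounded_functional "int_mu psi" "\<bar>psi 1\<bar> + \<bar>psi 0\<bar> + (LBINT x:{0..1}. \<bar>psi x\<bar>)"
    by (rule int_mu_bounded_functional[OF psi])
  define J where "J f = int_mu psi (\<lambda>x. f (\<phi> x))" for f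
  interpret J: bounded_functional J B using assms(9) unfolding J_def[abs_def] .
  obtain l r \<theta> where
    I_conc: "\<And>w K. w \<in> conc K \<Longrightarrow> ironed l r \<theta> w \<in> conc K" and
    I_le: "\<And>w K x. w \<in> conc K \<Longrightarrow> x \<in> {0..1} \<Longrightarrow> ironed l r \<theta> w x \<le> w x" and
    I_J: "\<And>w K. w \<in> conc K \<Longrightarrow> J (ironed l r \<theta> w) \<le> J w" and
    I_mono: "\<And>v w K. v \<in> conc K \<Longrightarrow> w \<in> conc K \<Longrightarrow> \<forall>x\<in>{0..1}. w x \<le> v x
      \<Longrightarrow> J (ironed l r \<theta> v) \<le> J (ironed l r \<theta> w)"
    by (rule J.ironing) (rule that)
  define W where "W u x = ubar (\<phi> x) - u (\<phi> x)" for u x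
  have DW: "u \<in> D \<longleftrightarrow> W u \<in> conc K" for u unfolding W_def[abs_def] by (rule D)
  define sel where "sel ul x = ubar x - ironed l r \<theta> (W ul) (\<phi> x)" for ul x
  have W_sel: "W (sel ul) = ironed l r \<theta> (W ul)" for ul
    by (auto simp: W_def sel_def phi(2))
  have sel_D: "sel ul \<in> D" if "ul \<in> D" for ul
    using that I_conc unfolding DW W_sel by blast
  have sel_U: "sel ul \<in> Uint ubar sl sh ul" if "ul \<in> D" for ul
  proof -
    have "ul x \<le> sel ul x" if x: "x \<in> {0..1}" for x
      using I_le[OF _ phi(1)[OF x], of "W ul" K] \<open>ul \<in> D\<close>
      unfolding DW by (simp add: sel_def W_def phi(2))
    then show ?thesis using sel_D[OF that] D_KS by (auto simp: Uint_def)
  qed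
  \<comment> \<open>The \<open>\<phi>\<close> in \<open>J\<close> cancels the one in
    \<open>W\<close>, so minimising \<open>J\<close> over the gaps is maximising the integral over
    the interval.\<close>
  have J_W: "J (W u) = int_mu psi ubar - int_mu psi u" if "u \<in> D" for u
    using mu.diff[OF ubar KS_continuous, of u ubar sl sh] D_KS that by (auto simp: J_def W_def phi(2))
  \<comment> \<open>A competitor above \<open>ul\<close> has the smaller gap. Antitonicity compares
    the two ironed gaps, and ironing the gap of the competitor does not increase
    \<open>J\<close>.\<close>
  have opt: "int_mu psi u \<le> int_mu psi (sel ul)" if ul: "ul \<in> D" and u: "u \<in> Uint ubar sl sh ul" for ul u
  proof -
    have uD: "u \<in> D" by (rule D_up[OF ul u])
    have "J (ironed l r \<theta> (W ul)) \<le> J (ironed l r \<theta> (W u))"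
      using ul uD u phi(1) by (intro I_mono[of _ K]) (auto simp: DW Uint_def W_def)
    also have "\<dots> \<le> J (W u)" using uD by (intro I_J[of _ K]) (simp add: DW)
    finally have "J (W (sel ul)) \<le> J (W u)" by (simp add: W_sel)
    then show ?thesis using J_W[OF uD] J_W[OF sel_D[OF ul]] by simp
  qed
  \<comment> \<open>The ironing parameters are the same for all lower boundaries, and
    \<open>ubar\<close> is reproduced because the coefficients sum to \<open>1\<close>.\<close>
  have sel_lin: "sel (\<lambda>y. a * ul1 y + (1 - a) * ul2 y) x = a * sel ul1 x + (1 - a) * sel ul2 x" for a ul1 ul2 x
    by (simp add: sel_def ironed_def W_def algebra_simps)
  have cont: "continuous_on {0..1} (sel ul)" if "ul \<in> D" for ul
    using sel_D[OF that] D_KS KS_continuous by blast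
  show ?thesis
  proof (intro exI[of _ sel] conjI ballI)
    show "linear_argmax_selection ubar sl sh psi D sel"
      unfolding linear_argmax_selection_def using sel_U opt sel_lin by blast
    fix ul1 ul2 a assume "ul1 \<in> D" "ul2 \<in> D"
    then show "int_signed nup nun (sel (\<lambda>y. a * ul1 y + (1 - a) * ul2 y))
      = a * int_signed nup nun (sel ul1) + (1 - a) * int_signed nup nun (sel ul2)"
      by (intro int_signed_mix nup nun cont sel_lin)
  qed
qed

section \<open>Reduction of the affine cases to the cone\<close>

text \<open>Subtracting from an affine function of slope \<open>sh\<close> turns convexity into
  concavity and slopes in \<open>{sl..sh}\<close> into slopes in \<open>{0..sh - sl}\<close>. In the
  converse direction, \<open>u \<le> ubar\<close> comes from monotonicity of the gap and its value
  \<open>0\<close> at \<open>0\<close>.\<close>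

lemma KS0_iff_conc:
  assumes aff: "\<And>x. x \<in> {0..1} \<Longrightarrow> ubar x = ubar 0 + sh * x"
  shows "u \<in> KS0 ubar sl sh \<longleftrightarrow> (\<lambda>x. ubar x - u x) \<in> conc (sh - sl)"
proof
  have aff_mix: "ubar (a * x + b * y) = a * ubar x + b * ubar y"
    if *: "x \<in> {0..1}" "y \<in> {0..1}" "0 \<le> a" "0 \<le> b" "a + b = 1" for x y a b
  proof -
    have "ubar (a * x + b * y) = (a + b) * ubar 0 + sh * (a * x + b * y)"
      using aff[OF mix_in_Icc[OF *]] *(5) by simp
    also have "\<dots> = a * (ubar 0 + sh * x) + b * (ubar 0 + sh * y)" by (simp add: algebra_simps)
    finally show ?thesis using aff[OF *(1)] aff[OF *(2)] by simp
  qed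
  have aff_diff: "ubar y - ubar x = sh * (y - x)" if "x \<in> {0..1}" "y \<in> {0..1}" for x y
    using aff[OF that(1)] aff[OF that(2)] by (simp add: algebra_simps)
  {
    assume "u \<in> KS0 ubar sl sh"
    then have u: "u \<in> KS ubar sl sh" and u0: "u 0 = ubar 0" by (auto simp: KS0_def)
    show "(\<lambda>x. ubar x - u x) \<in> conc (sh - sl)"
      unfolding conc_def mem_Collect_eq
    proof (intro conjI ballI impI)
      show "concave_on {0..1} (\<lambda>x. ubar x - u x)"
        unfolding concave_on_iff
      proof (intro conjI ballI allI impI)
        fix x y a b :: real
        assume *: "x \<in> {0..1}" "y \<in> {0..1}" "0 \<le> a" "0 \<le> b" "a + b = 1"
        show "a * (ubar x - u x) + b * (ubar y - u y) \<le> ubar (a *\<^sub>R x + b *\<^sub>R y) - u (a *\<^sub>R x + b *\<^sub>R y)"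
          using convex_on_realD[OF KS_D(1)[OF u] *] aff_mix[OF *] by (simp add: algebra_simps)
      qed simp
      show "ubar 0 - u 0 = 0" using u0 by simp
    next
      fix x y :: real assume *: "x \<in> {0..1}" "y \<in> {0..1}" "x \<le> y"
      show "ubar x - u x \<le> ubar y - u y" "ubar y - u y - (ubar x - u x) \<le> (sh - sl) * (y - x)"
        using KS_D(3)[OF u *] aff_diff[OF *(1,2)] by (auto simp: left_diff_distrib)
    qed
  next
    assume w: "(\<lambda>x. ubar x - u x) \<in> conc (sh - sl)"
    have "u \<in> KS ubar sl sh"
    proof (rule KS_I)
      fix x y a b :: real
      assume *: "x \<in> {0..1}" "y \<in> {0..1}" "0 \<le> a" "0 \<le> b" "a + b = 1"
      have "a * (ubar x - u x) + b * (ubar y - u y) \<le> ubar (a *\<^sub>R x + b *\<^sub>R y) - u (a *\<^sub>R x + b *\<^sub>R y)"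
        using concD(1)[OF w] * unfolding concave_on_iff by blast
      then show "u (a * x + b * y) \<le> a * u x + b * u y"
        using aff_mix[OF *] by (simp add: algebra_simps)
    next
      fix x :: real assume "x \<in> {0..1}"
      then show "u x \<le> ubar x" using concD(2)[OF w] concD(3)[OF w, of 0 x] by simp
    next
      fix x y :: real assume *: "x \<in> {0..1}" "y \<in> {0..1}" "x \<le> y"
      show "sl * (y - x) \<le> u y - u x \<and> u y - u x \<le> sh * (y - x)"
        using concD(3,4)[OF w *] aff_diff[OF *(1,2)] by (simp add: left_diff_distrib)
    qed
    then show "u \<in> KS0 ubar sl sh" using concD(2)[OF w] by (simp add: KS0_def)
  }
qed

lemma KS_reflect:
  assumes u: "u \<in> KS ubar sl sh"
  shows "(\<lambda>x. u (1 - x)) \<in> KS (\<lambda>x. ubar (1 - x)) (- sh) (- sl)"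
proof (rule KS_I)
  fix x y a b :: real
  assume *: "x \<in> {0..1}" "y \<in> {0..1}" "0 \<le> a" "0 \<le> b" "a + b = 1"
  have "1 - (a * x + b * y) = a * (1 - x) + b * (1 - y)"
    using *(5) by (simp add: algebra_simps)
  then show "u (1 - (a * x + b * y)) \<le> a * u (1 - x) + b * u (1 - y)"
    using convex_on_realD[OF KS_D(1)[OF u], of "1 - x" "1 - y" a b] * by simp
next
  fix x :: real assume "x \<in> {0..1}"
  then show "u (1 - x) \<le> ubar (1 - x)" using KS_D(2)[OF u] by simp
next
  fix x y :: real assume "x \<in> {0..1}" "y \<in> {0..1}" "x \<le> y"
  then show "- sh * (y - x) \<le> u (1 - y) - u (1 - x) \<and> u (1 - y) - u (1 - x) \<le> - sl * (y - x)"
    using KS_D(3)[OF u, of "1 - y" "1 - x"] by (simp add: algebra_simps)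
qed

text \<open>Reflection exchanges the endpoints and replaces the slope bounds by \<open>- sh\<close>
  and \<open>- sl\<close>. It is an involution, so \<open>KS_reflect\<close> serves both
  directions.\<close>

lemma KS1_iff_KS0:
  "u \<in> KS1 ubar sl sh \<longleftrightarrow> (\<lambda>x. u (1 - x)) \<in> KS0 (\<lambda>x. ubar (1 - x)) (- sh) (- sl)"
  using KS_reflect[of u ubar sl sh] KS_reflect[of "\<lambda>x. u (1 - x)" "\<lambda>x. ubar (1 - x)" "- sh" "- sl"]
  by (auto simp: KS0_def KS1_def)

lemma constant_derivative_imp_affine:
  fixes f :: "real \<Rightarrow> real"
  assumes "\<forall>x\<in>{0..1}. (f has_real_derivative s) (at x within {0..1})" and x: "x \<in> {0..1}"
  shows "f x = f 0 + s * x"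
proof -
  have "((\<lambda>x. f x - s * x) has_field_derivative 0) (at x within {0..1})" if "x \<in> {0..1}" for x
    using assms(1) that by (auto intro!: derivative_eq_intros)
  then obtain c where "\<forall>x\<in>{0..1}. f x - s * x = c"
    using has_field_derivative_zero_constant[of "{0..1}" "\<lambda>x. f x - s * x"] by auto
  from bspec[OF this, of 0] bspec[OF this x] show ?thesis by simp
qed

section \<open>Linear selections for the two extreme slopes and concavity of the value\<close>

theorem theorem3:
  fixes sl sh :: real and ubar psi :: "real \<Rightarrow> real" and nup nun :: "real measure"
  assumes ubar_K: "ubar \<in> KX"
    and ubar_S: "\<forall>x\<in>{0<..<1}. subdiffX ubar x \<subseteq> {sl..sh}"
    and psi_int: "set_integrable lborel {0..1} psi"
    and nup: "finite_measure nup" "sets nup = sets borel"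
    and nun: "finite_measure nun" "sets nun = sets borel"
  shows
   "((\<forall>x\<in>{0..1}. (ubar has_real_derivative sh) (at x within {0..1})) \<longrightarrow>
       (\<exists>sel. linear_argmax_selection ubar sl sh psi (KS0 ubar sl sh) sel \<and>
          (\<forall>ul1\<in>KS0 ubar sl sh. \<forall>ul2\<in>KS0 ubar sl sh. \<forall>a\<in>{0..1::real}.
             int_signed nup nun (sel (\<lambda>y. a * ul1 y + (1 - a) * ul2 y))
             = a * int_signed nup nun (sel ul1) + (1 - a) * int_signed nup nun (sel ul2))))
    \<and>
    ((\<forall>x\<in>{0..1}. (ubar has_real_derivative sl) (at x within {0..1})) \<longrightarrow>
       (\<exists>sel. linear_argmax_selection ubar sl sh psi (KS1 ubar sl sh) sel \<and>
          (\<forall>ul1\<in>KS1 ubar sl sh. \<forall>ul2\<in>KS1 ubar sl sh. \<forall>a\<in>{0..1::real}.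
             int_signed nup nun (sel (\<lambda>y. a * ul1 y + (1 - a) * ul2 y))
             = a * int_signed nup nun (sel ul1) + (1 - a) * int_signed nup nun (sel ul2))))
    \<and>
    ((\<forall>ul\<in>KS ubar sl sh. \<exists>u\<in>Uint ubar sl sh ul.
        \<forall>w\<in>Uint ubar sl sh ul. int_mu psi w \<le> int_mu psi u) \<and>
     (\<forall>ul1\<in>KS ubar sl sh. \<forall>ul2\<in>KS ubar sl sh. \<forall>a\<in>{0..1::real}.
        a * Sup (int_mu psi ` Uint ubar sl sh ul1) + (1 - a) * Sup (int_mu psi ` Uint ubar sl sh ul2)
        \<le> Sup (int_mu psi ` Uint ubar sl sh (\<lambda>y. a * ul1 y + (1 - a) * ul2 y))))"
proof -
  interpret mu: bounded_functional "int_mu psi" "\<bar>psi 1\<bar> + \<bar>psi 0\<bar> + (LBINT x:{0..1}. \<bar>psi x\<bar>)"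
    by (rule int_mu_bounded_functional[OF psi_int])
  have cont: "continuous_on {0..1} ubar" using ubar_K by (simp add: KX_def)
  \<comment> \<open>At a point where the lower boundary meets \<open>ubar\<close>, every function of
    the interval is squeezed to the same value. Hence \<open>KS0\<close> and \<open>KS1\<close>
    contain the intervals above their members.\<close>
  have up: "u \<in> KS ubar sl sh \<and> u z = ubar z"
    if "ul z = ubar z" "u \<in> Uint ubar sl sh ul" "z \<in> {0..1}" for u ul z
    using that KS_D(2)[of u ubar sl sh z] by (force simp: Uint_def)
  have 1: "\<exists>sel. linear_argmax_selection ubar sl sh psi (KS0 ubar sl sh) sel \<and>
          (\<forall>ul1\<in>KS0 ubar sl sh. \<forall>ul2\<in>KS0 ubar sl sh. \<forall>a\<in>{0..1::real}.
             int_signed nup nun (sel (\<lambda>y. a * ul1 y + (1 - a) * ul2 y))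
             = a * int_signed nup nun (sel ul1) + (1 - a) * int_signed nup nun (sel ul2))"
    if der: "\<forall>x\<in>{0..1}. (ubar has_real_derivative sh) (at x within {0..1})"
  proof (rule linear_selection[where \<phi> = "\<lambda>x. x" and K = "sh - sl", OF psi_int nup nun cont])
    show "bounded_functional (\<lambda>f. int_mu psi (\<lambda>x. f x)) (\<bar>psi 1\<bar> + \<bar>psi 0\<bar> + (LBINT x:{0..1}. \<bar>psi x\<bar>))"
      by (rule int_mu_bounded_functional[OF psi_int])
    show "u \<in> KS0 ubar sl sh \<longleftrightarrow> (\<lambda>x. ubar x - u x) \<in> conc (sh - sl)" for u
      by (rule KS0_iff_conc) (rule constant_derivative_imp_affine[OF der])
    show "u \<in> KS0 ubar sl sh" if "ul \<in> KS0 ubar sl sh" "u \<in> Uint ubar sl sh ul" for ul u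
      using that up[of ul 0 u] by (simp add: KS0_def)
  qed (auto simp: KS0_def)
  have 2: "\<exists>sel. linear_argmax_selection ubar sl sh psi (KS1 ubar sl sh) sel \<and>
          (\<forall>ul1\<in>KS1 ubar sl sh. \<forall>ul2\<in>KS1 ubar sl sh. \<forall>a\<in>{0..1::real}.
             int_signed nup nun (sel (\<lambda>y. a * ul1 y + (1 - a) * ul2 y))
             = a * int_signed nup nun (sel ul1) + (1 - a) * int_signed nup nun (sel ul2))"
    if der: "\<forall>x\<in>{0..1}. (ubar has_real_derivative sl) (at x within {0..1})"
  \<comment> \<open>\<open>K\<close> is upper minus lower slope bound after reflection, where the
    upper bound is \<open>- sl\<close> and the lower one \<open>- sh\<close>.\<close>
  proof (rule linear_selection[where \<phi> = "\<lambda>x. 1 - x" and K = "- sl - - sh", OF psi_int nup nun cont])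
    show "bounded_functional (\<lambda>f. int_mu psi (\<lambda>x. f (1 - x))) (\<bar>psi 1\<bar> + \<bar>psi 0\<bar> + (LBINT x:{0..1}. \<bar>psi x\<bar>))"
      by (rule mu.reflection)
    have "ubar (1 - x) = ubar (1 - 0) + - sl * x" if "x \<in> {0..1}" for x
      using constant_derivative_imp_affine[OF der, of "1 - x"] constant_derivative_imp_affine[OF der, of 1] that
      by (simp add: algebra_simps)
    then show "u \<in> KS1 ubar sl sh \<longleftrightarrow> (\<lambda>x. ubar (1 - x) - u (1 - x)) \<in> conc (- sl - - sh)" for u
      unfolding KS1_iff_KS0 by (rule KS0_iff_conc)
    show "u \<in> KS1 ubar sl sh" if "ul \<in> KS1 ubar sl sh" "u \<in> Uint ubar sl sh ul" for ul u
      using that up[of ul 1 u] by (simp add: KS1_def)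
  qed (auto simp: KS1_def)
  have 3: "\<exists>u\<in>Uint ubar sl sh ul. \<forall>w\<in>Uint ubar sl sh ul. int_mu psi w \<le> int_mu psi u"
    if "ul \<in> KS ubar sl sh" for ul
    by (rule mu.Uint_max[OF cont that]) blast
  show ?thesis
    using 1 2 3 mu.Sup_Uint_concave[OF cont] by (intro conjI impI ballI) blast+
qed

end
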